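(* Let $k\ge 2$, $p\ge 0$, $m\ge 0$ be integers, and let $G$ be a simple graph that is $k$-weakly $(4kp-2p+2m)$-connected, i.e. for any two disjoint vertex sets $A,B$ with $A\neq\emptyset$ and $A\cup B\subsetneq V(G)$, $$d_{G-B}(A)\ge 4kp-2p+2m-k|B|.$$ Then $G$ has a spanning subgraph $H$ containing a packing (pairwise edge-disjoint collection) of $m$ spanning trees and $p$ spanning subgraphs each of which is $k$-rigid and $(2k-1)$-edge-connected, such that for each vertex $v$, $$d_H(v)\le\left\lceil\frac{d_G(v)}{2}\right\rceil+2kp-p+m.$$
   Context: Graphs are finite and loopless. $d_G(X)$ is the number of edges with exactly one end in $X$, $e_G(X)$ the number with both ends in $X$; $G-B$ deletes the vertices of $B$. A graph is $t$-edge-connected if $d(X)\ge t$ for every nonempty proper vertex subset $X$. For a set function $\ell$ on vertex subsets (zero on $\emptyset$, $\ell(v)=\ell(\{v\})$), a spanning subgraph $F$ of $H$ is $\ell$-sparse if $e_F(A)\le\sum_{v\in A}\ell(v)-\ell(A)$ for all $A\subseteq V(H)$; $H$ is $\ell$-rigid if it has a spanning $\ell$-sparse subgraph $F$ with $|E(F)|=\sum_{v\in V(H)}\ell(v)-\ell(V(H))$. $k$-rigid means $\ell_{k,2k-1}$-rigid, where $\ell_{k,2k-1}$ is $k$ on singletons and $2k-1$ on sets with at least two vertices. *)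

theory Defs
  imports Complex_Main "HOL-Library.Disjoint_Sets"
begin

record 'a graph =
  vertices :: "'a set"
  edges :: "'a set set"

definition simple_graph :: "'a graph \<Rightarrow> bool" where
  "simple_graph G \<longleftrightarrow>
     finite (vertices G) \<and> (\<forall>e\<in>edges G. e \<subseteq> vertices G \<and> card e = 2)"

definition spanning_subgraph :: "'a graph \<Rightarrow> 'a graph \<Rightarrow> bool" where
  "spanning_subgraph H G \<longleftrightarrow> vertices H = vertices G \<and> edges H \<subseteq> edges G"

definition delete_vertices :: "'a graph \<Rightarrow> 'a set \<Rightarrow> 'a graph" where
  "delete_vertices G B =
     \<lparr>vertices = vertices G - B, edges = {e \<in> edges G. e \<inter> B = {}}\<rparr>"

definition cut_size :: "'a graph \<Rightarrow> 'a set \<Rightarrow> nat" where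
  "cut_size G X = card {e \<in> edges G. card (e \<inter> X) = 1}"

definition induced_size :: "'a graph \<Rightarrow> 'a set \<Rightarrow> nat" where
  "induced_size G X = card {e \<in> edges G. e \<subseteq> X}"

definition degree :: "'a graph \<Rightarrow> 'a \<Rightarrow> nat" where
  "degree G v = card {e \<in> edges G. v \<in> e}"

definition edge_connected :: "int \<Rightarrow> 'a graph \<Rightarrow> bool" where
  "edge_connected t G \<longleftrightarrow>
     (\<forall>X. X \<noteq> {} \<and> X \<subset> vertices G \<longrightarrow> t \<le> int (cut_size G X))"

definition weakly_connected :: "int \<Rightarrow> int \<Rightarrow> 'a graph \<Rightarrow> bool" where
  "weakly_connected k t G \<longleftrightarrow>
     (\<forall>A B. A \<inter> B = {} \<and> A \<noteq> {} \<and> A \<union> B \<subset> vertices G \<longrightarrow>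
        t - k * int (card B) \<le> int (cut_size (delete_vertices G B) A))"

definition connected_graph :: "'a graph \<Rightarrow> bool" where
  "connected_graph G \<longleftrightarrow>
     (\<forall>u\<in>vertices G. \<forall>v\<in>vertices G. (u, v) \<in> {(x, y). {x, y} \<in> edges G}\<^sup>*)"

text \<open>A cycle is given by the list of its (distinct) vertices in cyclic order.\<close>

definition is_cycle :: "'a graph \<Rightarrow> 'a list \<Rightarrow> bool" where
  "is_cycle G c \<longleftrightarrow> 3 \<le> length c \<and> distinct c \<and>
     (\<forall>i<length c. {c ! i, c ! (Suc i mod length c)} \<in> edges G)"

text \<open>The graph without vertices counts as a tree.\<close>

definition is_tree :: "'a graph \<Rightarrow> bool" where
  "is_tree G \<longleftrightarrow> connected_graph G \<and> (\<nexists>c. is_cycle G c)"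

definition sparse :: "('a set \<Rightarrow> int) \<Rightarrow> 'a graph \<Rightarrow> bool" where
  "sparse l F \<longleftrightarrow>
     (\<forall>A \<subseteq> vertices F. int (induced_size F A) \<le> (\<Sum>v\<in>A. l {v}) - l A)"

definition rigid :: "('a set \<Rightarrow> int) \<Rightarrow> 'a graph \<Rightarrow> bool" where
  "rigid l H \<longleftrightarrow>
     (\<exists>F. spanning_subgraph F H \<and> sparse l F \<and>
        int (card (edges F)) = (\<Sum>v\<in>vertices H. l {v}) - l (vertices H))"

definition ell :: "int \<Rightarrow> int \<Rightarrow> 'a set \<Rightarrow> int" where
  "ell k l A = (if A = {} then 0 else if card A = 1 then k else l)"

definition k_rigid :: "int \<Rightarrow> 'a graph \<Rightarrow> bool" where
  "k_rigid k H \<longleftrightarrow> rigid (ell k (2 * k - 1)) H"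

end

theory Submission
  imports Defs
begin

text \<open>
  Let \<open>c = kp + m\<close> and \<open>T = (2k - 1)p + m\<close>, so that \<open>G\<close> is \<open>k\<close>-weakly \<open>2T\<close>-connected. First find
  edge-disjoint bases \<open>F\<^sub>i\<close> of the count matroids \<open>e(A) \<le> \<kappa>|A| - (2\<kappa> - 1)\<close>, with \<open>\<kappa> = 1\<close> for the
  trees and \<open>\<kappa> = k\<close> for the rigid graphs, such that the edges outside \<open>F = \<Union>F\<^sub>i\<close> can be oriented with
  in-degree at most \<open>\<lceil>d(v)/2\<rceil> + c - d\<^sub>F(v)\<close> at every vertex \<open>v\<close>. Then at least \<open>T - c = (k - 1)p\<close> of
  these edges leave \<open>v\<close>, and giving \<open>k - 1\<close> of them to each rigid graph raises its degree at \<open>v\<close>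
  from at least \<open>k\<close> to at least \<open>2k - 1\<close>; all other cuts of a rigid graph have \<open>2k - 1\<close> edges anyway.
  The degree of \<open>v\<close> in the union is at most \<open>\<lceil>d(v)/2\<rceil> + c + (k - 1)p = \<lceil>d(v)/2\<rceil> + T\<close>.

  The orientation exists iff, for every vertex set \<open>X\<close>, at most
  \<open>b(X) = (\<Sum>v\<in>X. \<lceil>d(v)/2\<rceil> + c) - e\<^sub>G(X)\<close> edges of \<open>F\<close> meet \<open>X\<close>. This condition defines a matroid, so
  matroid intersection on pairs (edge, index) reduces the existence of the \<open>F\<^sub>i\<close> to the inequality
  \<open>p r\<^sub>k(Y) + m r\<^sub>1(Y) + |E(U) - Y| + b(V - U) \<ge> c|V| - T\<close> for \<open>Y \<subseteq> E(U)\<close>, where \<open>r\<^sub>\<kappa>\<close> is the rank in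
  the count matroid. The rank \<open>r\<^sub>\<kappa>(Y)\<close> is the sum of \<open>\<kappa>|Z| - (2\<kappa> - 1)\<close> over a family of vertex sets
  \<open>Z\<close> covering \<open>Y\<close>; applying weak connectivity to the vertices of \<open>Z\<close> lying in no other set of the
  family, with the shared vertices of \<open>Z\<close> deleted, gives enough edges outside \<open>Y\<close>.
\<close>

section \<open>Matroid intersection\<close>


text \<open>These conditions survive restriction to a subset and contraction of an element of rank
  one, the two operations of the induction below.\<close>

definition rank_function :: "'b set \<Rightarrow> ('b set \<Rightarrow> int) \<Rightarrow> bool" where
  "rank_function E r \<longleftrightarrow> r {} = 0 \<and> (\<forall>e\<in>E. r {e} \<le> 1) \<and>
     (\<forall>X Y. X \<subseteq> E \<longrightarrow> Y \<subseteq> E \<longrightarrow> r (X \<union> Y) + r (X \<inter> Y) \<le> r X + r Y)"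

lemma rank_function_submodular:
  assumes "rank_function E r" "X \<subseteq> E" "Y \<subseteq> E"
  shows "r (X \<union> Y) + r (X \<inter> Y) \<le> r X + r Y"
  using assms unfolding rank_function_def by blast

lemma rank_function_subset:
  assumes "rank_function E r" "E' \<subseteq> E"
  shows "rank_function E' r"
  using assms unfolding rank_function_def by (meson subset_eq)

lemma rank_function_contract:
  assumes r: "rank_function E r" and e: "e \<in> E" "r {e} = 1"
  shows "rank_function (E - {e}) (\<lambda>X. r (insert e X) - 1)"
proof -
  have "r {e, f} - 1 \<le> 1" if "f \<in> E - {e}" for f
  proof -
    have "r ({e} \<union> {f}) + r ({e} \<inter> {f}) \<le> r {e} + r {f}"
      using that e by (intro rank_function_submodular[OF r]) auto
    moreover have "r {f} \<le> 1" "r {} = 0" using r that unfolding rank_function_def by auto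
    ultimately show ?thesis using e that by (simp add: insert_commute)
  qed
  moreover have "r (insert e (X \<union> Y)) + r (insert e (X \<inter> Y)) \<le> r (insert e X) + r (insert e Y)"
    if "X \<subseteq> E - {e}" "Y \<subseteq> E - {e}" for X Y
    using rank_function_submodular[OF r, of "insert e X" "insert e Y"] that e(1) by auto
  ultimately show ?thesis using e(2) by (simp add: rank_function_def)
qed

lemma rank_function_loops:
  assumes r: "rank_function E r" and "finite X" "X \<subseteq> E" "\<And>e. e \<in> X \<Longrightarrow> r {e} \<le> 0"
  shows "r X \<le> 0"
  using assms(2-)
proof (induction X rule: finite_induct)
  case empty
  then show ?case using r by (simp add: rank_function_def)
next
  case (insert e X)
  have "r ({e} \<union> X) + r ({e} \<inter> X) \<le> r {e} + r X"
    using insert.prems by (intro rank_function_submodular[OF r]) auto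
  moreover have "r {} = 0" using r by (simp add: rank_function_def)
  ultimately show ?case using insert by fastforce
qed

text \<open>Edmonds' theorem, by induction on \<open>E\<close>. An element \<open>e\<close> of rank
  one in both functions is deleted if the bound survives this. Otherwise it is contracted, with
  \<open>q\<close> lowered by one, and put back into the common independent set so obtained.
  Independence is expressed by \<open>r I = int (card I)\<close>.\<close>

theorem matroid_intersection:
  assumes "finite E" "rank_function E r1" "rank_function E r2"
    and "\<And>X. X \<subseteq> E \<Longrightarrow> q \<le> r1 X + r2 (E - X)"
  shows "\<exists>I\<subseteq>E. r1 I = int (card I) \<and> r2 I = int (card I) \<and> q \<le> int (card I)"
  using assms
proof (induction E arbitrary: r1 r2 q rule: finite_psubset_induct)
  case (psubset E)
  note r1 = psubset.prems(1) and r2 = psubset.prems(2) and bound = psubset.prems(3)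
  have le1: "r1 {e} \<le> 1" "r2 {e} \<le> 1" if "e \<in> E" for e
    using r1 r2 that by (auto simp: rank_function_def)
  show ?case
  proof (cases "\<exists>e\<in>E. r1 {e} = 1 \<and> r2 {e} = 1")
    case False
    \<comment> \<open>The loops of \<open>r1\<close>. By the case assumption all other elements are
      loops of \<open>r2\<close>, so the bound at this \<open>X\<close> forces
      \<open>q \<le> 0\<close> and the empty set suffices.\<close>
    define X where "X = {e\<in>E. r1 {e} \<le> 0}"
    have "r1 X \<le> 0"
      by (rule rank_function_loops[OF r1]) (use psubset.hyps(1) in \<open>auto simp: X_def\<close>)
    moreover have "r2 (E - X) \<le> 0"
    proof (rule rank_function_loops[OF r2])
      fix e assume that: "e \<in> E - X"
      have "r1 {e} = 1" using that le1(1)[of e] unfolding X_def by auto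
      then have "r2 {e} \<noteq> 1" using False that by blast
      then show "r2 {e} \<le> 0" using le1(2)[of e] that by auto
    qed (use psubset.hyps(1) in auto)
    moreover have "q \<le> r1 X + r2 (E - X)" by (rule bound) (auto simp: X_def)
    ultimately have "q \<le> 0" by linarith
    then show ?thesis
      using r1 r2 by (intro exI[of _ "{}"]) (auto simp: rank_function_def)
  next
    case True
    then obtain e where e: "e \<in> E" "r1 {e} = 1" "r2 {e} = 1" by auto
    let ?E = "E - {e}"
    have sub: "?E \<subset> E" using e by auto
    show ?thesis
    proof (cases "\<forall>X\<subseteq>?E. q \<le> r1 X + r2 (?E - X)")
      case True
      have "\<exists>I\<subseteq>?E. r1 I = int (card I) \<and> r2 I = int (card I) \<and> q \<le> int (card I)"
        by (rule psubset.IH[OF sub rank_function_subset[OF r1 Diff_subset]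
              rank_function_subset[OF r2 Diff_subset]]) (use True in blast)
      then show ?thesis by blast
    next
      case False
      then obtain X where X: "X \<subseteq> ?E" "r1 X + r2 (?E - X) < q" by (meson not_le)
      \<comment> \<open>Uncrossing: submodularity compares the terms of the violating set
        \<open>X\<close>, at most \<open>q - 1\<close> in total, and those of \<open>Y\<close> with
        the original bound at \<open>X \<inter> Y\<close> and at
        \<open>X \<union> insert e Y\<close>, together at least \<open>2 * q\<close>.\<close>
      have "q - 1 \<le> (r1 (insert e Y) - 1) + (r2 (insert e (?E - Y)) - 1)" if Y: "Y \<subseteq> ?E" for Y
      proof -
        have "r1 (X \<union> insert e Y) + r1 (X \<inter> insert e Y) \<le> r1 X + r1 (insert e Y)"
          using X Y e by (intro rank_function_submodular[OF r1]) auto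
        moreover have "X \<inter> insert e Y = X \<inter> Y" using X by auto
        moreover have "r2 ((?E - X) \<union> insert e (?E - Y)) + r2 ((?E - X) \<inter> insert e (?E - Y))
            \<le> r2 (?E - X) + r2 (insert e (?E - Y))"
          using X Y e by (intro rank_function_submodular[OF r2]) auto
        moreover have "(?E - X) \<union> insert e (?E - Y) = E - (X \<inter> Y)"
          "(?E - X) \<inter> insert e (?E - Y) = E - (X \<union> insert e Y)" using X Y e by auto
        moreover have "q \<le> r1 (X \<inter> Y) + r2 (E - (X \<inter> Y))" using X by (intro bound) auto
        moreover have "q \<le> r1 (X \<union> insert e Y) + r2 (E - (X \<union> insert e Y))"
          using X Y e by (intro bound) auto
        ultimately show ?thesis using X(2) by auto
      qed
      then have "\<exists>I\<subseteq>?E. r1 (insert e I) - 1 = int (card I) \<and>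
          r2 (insert e I) - 1 = int (card I) \<and> q - 1 \<le> int (card I)"
        by (rule psubset.IH[OF sub rank_function_contract[OF r1 e(1,2)]
              rank_function_contract[OF r2 e(1,3)]])
      then obtain I where I: "I \<subseteq> ?E" "r1 (insert e I) - 1 = int (card I)"
        "r2 (insert e I) - 1 = int (card I)" "q - 1 \<le> int (card I)" by blast
      have "finite I" "e \<notin> I" using I psubset.hyps finite_subset by auto
      then show ?thesis using I e by (intro exI[of _ "insert e I"]) auto
    qed
  qed
qed


section \<open>Count matroids\<close>

definition inside :: "'a set set \<Rightarrow> 'a set \<Rightarrow> 'a set set" where
  "inside F A = {e\<in>F. e \<subseteq> A}"

text \<open>The sparsity bound belonging to \<open>ell \<kappa> (2 * \<kappa> - 1)\<close> on at
  least two vertices: the forest count for \<open>\<kappa> = 1\<close>, the Laman count for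
  \<open>\<kappa> = 2\<close>.\<close>

definition capacity :: "int \<Rightarrow> 'a set \<Rightarrow> int" where
  "capacity \<kappa> A = \<kappa> * int (card A) - (2 * \<kappa> - 1)"

text \<open>Single vertices are left out because \<open>capacity\<close> is
  \<open>1 - \<kappa>\<close> on them, which is negative for \<open>\<kappa> > 1\<close>.\<close>

definition count_sparse :: "int \<Rightarrow> 'a set \<Rightarrow> 'a set set \<Rightarrow> bool" where
  "count_sparse \<kappa> V F \<longleftrightarrow> (\<forall>A\<subseteq>V. 2 \<le> card A \<longrightarrow> int (card (inside F A)) \<le> capacity \<kappa> A)"

definition tight :: "int \<Rightarrow> 'a set \<Rightarrow> 'a set set \<Rightarrow> 'a set \<Rightarrow> bool" where
  "tight \<kappa> V F A \<longleftrightarrow> A \<subseteq> V \<and> 2 \<le> card A \<and> int (card (inside F A)) = capacity \<kappa> A"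

definition count_rank :: "int \<Rightarrow> 'a set \<Rightarrow> 'a set set \<Rightarrow> int" where
  "count_rank \<kappa> V Y = int (Max (card ` {F. F \<subseteq> Y \<and> count_sparse \<kappa> V F}))"

lemma capacity_nonneg:
  assumes "1 \<le> \<kappa>" "2 \<le> card A"
  shows "0 \<le> capacity \<kappa> A"
proof -
  have "\<kappa> * 2 \<le> \<kappa> * int (card A)" using assms by (intro mult_left_mono) auto
  then show ?thesis by (simp add: capacity_def)
qed

lemma inside_subset: "inside F A \<subseteq> F"
  by (auto simp: inside_def)

lemma inside_mono: "F \<subseteq> F' \<Longrightarrow> A \<subseteq> A' \<Longrightarrow> inside F A \<subseteq> inside F' A'"
  by (auto simp: inside_def)

lemma finite_inside: "finite F \<Longrightarrow> finite (inside F A)"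
  by (simp add: inside_def)

lemma count_sparse_subset:
  assumes "count_sparse \<kappa> V F" "F' \<subseteq> F" "finite F"
  shows "count_sparse \<kappa> V F'"
  unfolding count_sparse_def
proof (intro allI impI)
  fix A assume A: "A \<subseteq> V" "2 \<le> card A"
  have "card (inside F' A) \<le> card (inside F A)"
    using assms by (intro card_mono finite_inside inside_mono) auto
  also have "int \<dots> \<le> capacity \<kappa> A" using assms(1) A by (simp add: count_sparse_def)
  finally show "int (card (inside F' A)) \<le> capacity \<kappa> A" by simp
qed

lemma card_inside_supermodular:
  assumes "finite F"
  shows "card (inside F A) + card (inside F B) \<le> card (inside F (A \<union> B)) + card (inside F (A \<inter> B))"
proof -
  have "card (inside F A) + card (inside F B)
      = card (inside F A \<union> inside F B) + card (inside F A \<inter> inside F B)"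
    using assms by (intro card_Un_Int finite_inside)
  moreover have "card (inside F A \<union> inside F B) \<le> card (inside F (A \<union> B))"
    using assms by (intro card_mono finite_inside) (auto simp: inside_def)
  moreover have "inside F A \<inter> inside F B = inside F (A \<inter> B)" by (auto simp: inside_def)
  ultimately show ?thesis by simp
qed

locale simple_edges =
  fixes V :: "'a set" and E :: "'a set set"
  assumes finite_V: "finite V"
    and edge: "\<And>e. e \<in> E \<Longrightarrow> e \<subseteq> V \<and> card e = 2"
begin

lemma finite_E: "finite E"
  by (rule finite_subset[of _ "Pow V"]) (use finite_V edge in auto)

lemma finite_edges: "F \<subseteq> E \<Longrightarrow> finite F"
  using finite_E finite_subset by auto

lemma finite_edge: "e \<in> E \<Longrightarrow> finite e"
  using edge[of e] finite_V finite_subset by auto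

lemma inside_small:
  assumes "F \<subseteq> E" "finite A" "card A \<le> 1"
  shows "inside F A = {}"
proof -
  have False if "e \<in> F" "e \<subseteq> A" for e
    using card_mono[OF assms(2) that(2)] edge[of e] that assms by auto
  then show ?thesis by (auto simp: inside_def)
qed

text \<open>Uncrossing: \<open>capacity\<close> is modular and the number of inner edges
  supermodular, so equality passes to the union once \<open>A \<inter> B\<close> obeys the sparsity
  bound. For \<open>\<kappa> = 1\<close> a single common vertex also does, its capacity being
  zero.\<close>

lemma tight_Un:
  assumes F: "F \<subseteq> E" "count_sparse \<kappa> V F" and A: "tight \<kappa> V F A" and B: "tight \<kappa> V F B"
    and AB: "2 \<le> card (A \<inter> B) \<or> \<kappa> = 1 \<and> A \<inter> B \<noteq> {}"
  shows "tight \<kappa> V F (A \<union> B)"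
proof -
  have fin: "finite A" "finite B" using A B finite_V finite_subset unfolding tight_def by auto
  have "int (card (inside F (A \<inter> B))) \<le> capacity \<kappa> (A \<inter> B)"
  proof (cases "2 \<le> card (A \<inter> B)")
    case True
    then show ?thesis using F A unfolding count_sparse_def tight_def by (meson inf.coboundedI1)
  next
    case False
    then have "card (A \<inter> B) \<le> 1" "\<kappa> = 1" "card (A \<inter> B) \<noteq> 0" using AB fin by auto
    then have "1 \<le> card (A \<inter> B)" by linarith
    with \<open>card (A \<inter> B) \<le> 1\<close> \<open>\<kappa> = 1\<close> show ?thesis
      using inside_small[OF F(1), of "A \<inter> B"] fin by (simp add: capacity_def)
  qed
  moreover have "int (card (inside F A)) + int (card (inside F B))
      \<le> int (card (inside F (A \<union> B))) + int (card (inside F (A \<inter> B)))"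
    using card_inside_supermodular[OF finite_edges[OF F(1)], of A B] by linarith
  moreover have "capacity \<kappa> A + capacity \<kappa> B = capacity \<kappa> (A \<union> B) + capacity \<kappa> (A \<inter> B)"
  proof -
    have "int (card A) + int (card B) = int (card (A \<union> B)) + int (card (A \<inter> B))"
      using card_Un_Int[OF fin] by linarith
    then have "\<kappa> * (int (card A) + int (card B)) = \<kappa> * (int (card (A \<union> B)) + int (card (A \<inter> B)))"
      by simp
    then show ?thesis by (simp add: capacity_def algebra_simps)
  qed
  moreover have sub: "A \<union> B \<subseteq> V" "2 \<le> card (A \<union> B)"
    using A B fin card_mono[of "A \<union> B" A] unfolding tight_def by auto
  moreover have "int (card (inside F (A \<union> B))) \<le> capacity \<kappa> (A \<union> B)"
    using F(2) sub by (simp add: count_sparse_def)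
  ultimately show ?thesis using A B unfolding tight_def by auto
qed

text \<open>Two vertices have capacity one for every \<open>\<kappa>\<close>. Hence every edge of
  \<open>F\<close> lies in a maximal tight set.\<close>

lemma tight_edge:
  assumes "F \<subseteq> E" "count_sparse \<kappa> V F" "e \<in> F"
  shows "tight \<kappa> V F e"
proof -
  have e: "e \<subseteq> V" "card e = 2" "finite e" using assms edge finite_edge by auto
  have "e' = e" if "e' \<in> F" "e' \<subseteq> e" for e'
    using that assms(1) edge[of e'] e by (metis card_subset_eq subsetD)
  then have "inside F e = {e}" using assms by (auto simp: inside_def)
  then show ?thesis using e by (simp add: tight_def capacity_def)
qed

text \<open>Removing a vertex that lies on no edge inside \<open>A\<close> would lower the capacity
  by \<open>\<kappa>\<close> but keep all inner edges, against sparsity; from two vertices it would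
  leave one vertex spanning an edge.\<close>

lemma tight_vertex_in_edge:
  assumes F: "F \<subseteq> E" "count_sparse \<kappa> V F" and A: "tight \<kappa> V F A" and v: "v \<in> A" and \<kappa>: "1 \<le> \<kappa>"
  shows "\<exists>e\<in>F. v \<in> e \<and> e \<subseteq> A"
proof (rule ccontr)
  assume *: "\<not> ?thesis"
  have fin: "finite A" using A finite_V finite_subset unfolding tight_def by auto
  have eq: "inside F (A - {v}) = inside F A" using * by (auto simp: inside_def)
  have card: "card (A - {v}) = card A - 1" using v fin by simp
  have A2: "2 \<le> card A" "int (card (inside F A)) = capacity \<kappa> A" "A \<subseteq> V" using A unfolding tight_def by auto
  show False
  proof (cases "card A = 2")
    case True
    then have "inside F (A - {v}) = {}" using card fin by (intro inside_small F) auto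
    then show False using eq A2 True by (simp add: capacity_def)
  next
    case False
    then have "2 \<le> card (A - {v})" using A2(1) card by linarith
    then have "int (card (inside F (A - {v}))) \<le> capacity \<kappa> (A - {v})"
      using F(2) A2(3) unfolding count_sparse_def by (meson Diff_subset subset_trans)
    moreover have "capacity \<kappa> (A - {v}) = capacity \<kappa> A - \<kappa>"
      using card A2 by (simp add: capacity_def of_nat_diff algebra_simps)
    ultimately show False using eq A2 \<kappa> by simp
  qed
qed

lemma count_sparse_empty: "1 \<le> \<kappa> \<Longrightarrow> count_sparse \<kappa> V {}"
  by (simp add: count_sparse_def inside_def capacity_nonneg)

text \<open>Weak duality for the rank formula: each covering set spans at most its capacity many
  edges of \<open>F\<close>.\<close>

lemma card_le_cover:
  assumes F: "F \<subseteq> E" "count_sparse \<kappa> V F" and \<Z>: "\<And>Z. Z \<in> \<Z> \<Longrightarrow> Z \<subseteq> V \<and> 2 \<le> card Z"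
    and cover: "\<And>e. e \<in> F \<Longrightarrow> \<exists>Z\<in>\<Z>. e \<subseteq> Z"
  shows "int (card F) \<le> (\<Sum>Z\<in>\<Z>. capacity \<kappa> Z)"
proof -
  have fin: "finite \<Z>" by (rule finite_subset[of _ "Pow V"]) (use finite_V \<Z> in auto)
  have "F = (\<Union>Z\<in>\<Z>. inside F Z)" using cover by (auto simp: inside_def)
  then have "card F \<le> (\<Sum>Z\<in>\<Z>. card (inside F Z))"
    using card_UN_le[OF fin, of "inside F"] by simp
  then have "int (card F) \<le> (\<Sum>Z\<in>\<Z>. int (card (inside F Z)))"
    using of_nat_mono by fastforce
  also have "\<dots> \<le> (\<Sum>Z\<in>\<Z>. capacity \<kappa> Z)"
    using F \<Z> unfolding count_sparse_def by (intro sum_mono) auto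
  finally show ?thesis .
qed

text \<open>Maximal tight sets overlap too little to be merged, so each edge of a maximal sparse
  set lies in exactly one of them.\<close>

lemma maximal_sparse_cover:
  assumes Y: "Y \<subseteq> E" and \<kappa>: "1 \<le> \<kappa>" and F: "F \<subseteq> Y" "count_sparse \<kappa> V F"
    and maximal: "\<And>e. e \<in> Y - F \<Longrightarrow> \<not> count_sparse \<kappa> V (insert e F)"
  obtains \<Z> where "\<And>Z. Z \<in> \<Z> \<Longrightarrow> Z \<subseteq> V \<and> 2 \<le> card Z"
    "\<And>Z v. Z \<in> \<Z> \<Longrightarrow> v \<in> Z \<Longrightarrow> \<exists>e\<in>Y. v \<in> e \<and> e \<subseteq> Z"
    "\<kappa> = 1 \<Longrightarrow> pairwise disjnt \<Z>"
    "\<And>e. e \<in> Y \<Longrightarrow> \<exists>Z\<in>\<Z>. e \<subseteq> Z"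
    "int (card F) = (\<Sum>Z\<in>\<Z>. capacity \<kappa> Z)"
proof -
  define \<Z> where "\<Z> = {Z. tight \<kappa> V F Z \<and> (\<forall>Z'. tight \<kappa> V F Z' \<longrightarrow> Z \<subseteq> Z' \<longrightarrow> Z' = Z)}"
  have FE: "F \<subseteq> E" using F Y by auto
  have \<Z>: "Z \<subseteq> V" "2 \<le> card Z" "int (card (inside F Z)) = capacity \<kappa> Z" if "Z \<in> \<Z>" for Z
    using that unfolding \<Z>_def tight_def by auto
  have fin: "finite \<Z>" by (rule finite_subset[of _ "Pow V"]) (use finite_V \<Z> in auto)
  have maxl: "\<exists>Z\<in>\<Z>. A \<subseteq> Z" if A: "tight \<kappa> V F A" for A
  proof -
    have "finite {Z. tight \<kappa> V F Z}"
      by (rule finite_subset[of _ "Pow V"]) (use finite_V in \<open>auto simp: tight_def\<close>)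
    from finite_has_maximal2[OF this, of A] A obtain Z where
      "A \<subseteq> Z" "tight \<kappa> V F Z" "\<forall>Z'. tight \<kappa> V F Z' \<longrightarrow> Z \<subseteq> Z' \<longrightarrow> Z = Z'" by auto
    then show ?thesis unfolding \<Z>_def by blast
  qed
  have meet: "\<not> (2 \<le> card (Z \<inter> Z') \<or> \<kappa> = 1 \<and> Z \<inter> Z' \<noteq> {})"
    if "Z \<in> \<Z>" "Z' \<in> \<Z>" "Z \<noteq> Z'" for Z Z'
    using tight_Un[OF FE F(2), of Z Z'] that unfolding \<Z>_def
    by (smt (verit, best) mem_Collect_eq sup.cobounded1 sup.cobounded2)
  have cover: "\<exists>Z\<in>\<Z>. e \<subseteq> Z" if e: "e \<in> Y" for e
  proof (cases "e \<in> F")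
    case True
    then show ?thesis using maxl[OF tight_edge[OF FE F(2)]] by auto
  next
    case False
    \<comment> \<open>A set violated by \<open>insert e F\<close> but not by \<open>F\<close> must
      contain \<open>e\<close> and be tight for \<open>F\<close>.\<close>
    then obtain A where A: "A \<subseteq> V" "2 \<le> card A" "\<not> int (card (inside (insert e F) A)) \<le> capacity \<kappa> A"
      using maximal[of e] e unfolding count_sparse_def by auto
    have le: "int (card (inside F A)) \<le> capacity \<kappa> A"
      using A F(2) unfolding count_sparse_def by auto
    have "e \<subseteq> A"
    proof (rule ccontr)
      assume "\<not> e \<subseteq> A"
      then have "inside (insert e F) A = inside F A" by (auto simp: inside_def)
      then show False using A le by simp
    qed
    then have "inside (insert e F) A = insert e (inside F A)" "e \<notin> inside F A"
      using False by (auto simp: inside_def)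
    then have "card (inside (insert e F) A) = Suc (card (inside F A))"
      using finite_inside[OF finite_edges[OF FE]] by simp
    then have "tight \<kappa> V F A" using A le unfolding tight_def by linarith
    then show ?thesis using maxl[of A] \<open>e \<subseteq> A\<close> by (meson subset_trans)
  qed
  have "F = (\<Union>Z\<in>\<Z>. inside F Z)" using cover F by (auto simp: inside_def)
  moreover have "card (\<Union>Z\<in>\<Z>. inside F Z) = (\<Sum>Z\<in>\<Z>. card (inside F Z))"
  proof (intro card_UN_disjoint fin ballI impI finite_inside finite_edges FE)
    fix Z Z' assume ZZ: "Z \<in> \<Z>" "Z' \<in> \<Z>" "Z \<noteq> Z'"
    have "2 \<le> card (Z \<inter> Z')" if "e \<in> inside F Z \<inter> inside F Z'" for e
    proof -
      have "e \<subseteq> Z \<inter> Z'" "card e = 2" using that FE edge by (auto simp: inside_def)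
      moreover have "finite (Z \<inter> Z')" using \<Z>(1)[OF ZZ(1)] finite_V finite_subset by blast
      ultimately show ?thesis by (metis card_mono)
    qed
    then show "inside F Z \<inter> inside F Z' = {}" using meet[OF ZZ] by auto
  qed
  ultimately have "int (card F) = (\<Sum>Z\<in>\<Z>. int (card (inside F Z)))" by simp
  then have "int (card F) = (\<Sum>Z\<in>\<Z>. capacity \<kappa> Z)" using \<Z>(3) by simp
  moreover have "\<exists>e\<in>Y. v \<in> e \<and> e \<subseteq> Z" if "Z \<in> \<Z>" "v \<in> Z" for Z v
    using tight_vertex_in_edge[OF FE F(2) _ that(2) \<kappa>] that(1) F(1) unfolding \<Z>_def by blast
  moreover have "pairwise disjnt \<Z>" if "\<kappa> = 1"
    using meet that by (auto simp: pairwise_def disjnt_def)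
  ultimately show thesis using that[of \<Z>] \<Z> cover by blast
qed

lemma finite_sparse_sets: "Y \<subseteq> E \<Longrightarrow> finite {F. F \<subseteq> Y \<and> count_sparse \<kappa> V F}"
  by (rule finite_subset[of _ "Pow Y"]) (use finite_edges in auto)

lemma card_le_count_rank:
  assumes "Y \<subseteq> E" "F \<subseteq> Y" "count_sparse \<kappa> V F"
  shows "int (card F) \<le> count_rank \<kappa> V Y"
  unfolding count_rank_def of_nat_le_iff
  using assms by (intro Max_ge finite_imageI finite_sparse_sets) auto

lemma count_rank_attained:
  assumes "Y \<subseteq> E" "1 \<le> \<kappa>"
  obtains F where "F \<subseteq> Y" "count_sparse \<kappa> V F" "count_rank \<kappa> V Y = int (card F)"
proof -
  have "Max (card ` {F. F \<subseteq> Y \<and> count_sparse \<kappa> V F}) \<in> card ` {F. F \<subseteq> Y \<and> count_sparse \<kappa> V F}"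
    using assms count_sparse_empty by (intro Max_in finite_imageI finite_sparse_sets) auto
  then show thesis using that unfolding count_rank_def by auto
qed

text \<open>A maximal sparse subset attains the bound that its cover by maximal tight sets imposes
  on every sparse subset of \<open>Y\<close>. So maximal means maximum, the basis property of a
  matroid.\<close>

lemma maximal_sparse_card:
  assumes Y: "Y \<subseteq> E" and \<kappa>: "1 \<le> \<kappa>" and F: "F \<subseteq> Y" "count_sparse \<kappa> V F"
    and maximal: "\<And>e. e \<in> Y - F \<Longrightarrow> \<not> count_sparse \<kappa> V (insert e F)"
  shows "count_rank \<kappa> V Y = int (card F)"
proof -
  obtain \<Z> where \<Z>: "\<And>Z. Z \<in> \<Z> \<Longrightarrow> Z \<subseteq> V \<and> 2 \<le> card Z" "\<And>e. e \<in> Y \<Longrightarrow> \<exists>Z\<in>\<Z>. e \<subseteq> Z"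
    "int (card F) = (\<Sum>Z\<in>\<Z>. capacity \<kappa> Z)"
    using maximal_sparse_cover[OF Y \<kappa> F maximal] by metis
  obtain F' where F': "F' \<subseteq> Y" "count_sparse \<kappa> V F'" "count_rank \<kappa> V Y = int (card F')"
    using count_rank_attained[OF Y \<kappa>] .
  have "int (card F') \<le> int (card F)"
    unfolding \<Z>(3) using F' Y \<Z> by (intro card_le_cover) auto
  then show ?thesis using card_le_count_rank[OF Y F] F'(3) by simp
qed

text \<open>The rank formula, with a cover attaining it. The second property confines the covering
  sets to the vertices met by \<open>Y\<close>; disjointness for \<open>\<kappa> = 1\<close> makes
  every set its own private part.\<close>

lemma count_rank_cover:
  assumes Y: "Y \<subseteq> E" and \<kappa>: "1 \<le> \<kappa>"
  obtains \<Z> where "\<And>Z. Z \<in> \<Z> \<Longrightarrow> Z \<subseteq> V \<and> 2 \<le> card Z"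
    "\<And>Z v. Z \<in> \<Z> \<Longrightarrow> v \<in> Z \<Longrightarrow> \<exists>e\<in>Y. v \<in> e \<and> e \<subseteq> Z"
    "\<kappa> = 1 \<Longrightarrow> pairwise disjnt \<Z>"
    "\<And>e. e \<in> Y \<Longrightarrow> \<exists>Z\<in>\<Z>. e \<subseteq> Z"
    "count_rank \<kappa> V Y = (\<Sum>Z\<in>\<Z>. capacity \<kappa> Z)"
proof -
  obtain F where F: "F \<subseteq> Y" "count_sparse \<kappa> V F" "count_rank \<kappa> V Y = int (card F)"
    using count_rank_attained[OF Y \<kappa>] .
  have maximal: "\<not> count_sparse \<kappa> V (insert e F)" if e: "e \<in> Y - F" for e
  proof
    assume "count_sparse \<kappa> V (insert e F)"
    then have "int (card (insert e F)) \<le> count_rank \<kappa> V Y"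
      using F e by (intro card_le_count_rank[OF Y]) auto
    moreover have "finite F" using F Y by (intro finite_edges) auto
    ultimately show False using e F by simp
  qed
  show thesis
    by (rule maximal_sparse_cover[OF Y \<kappa> F(1,2) maximal, folded F(3)]) (assumption | rule that)+
qed

lemma count_rank_le_cover:
  assumes Y: "Y \<subseteq> E" and \<kappa>: "1 \<le> \<kappa>" and \<Z>: "\<And>Z. Z \<in> \<Z> \<Longrightarrow> Z \<subseteq> V \<and> 2 \<le> card Z"
    and cover: "\<And>e. e \<in> Y \<Longrightarrow> \<exists>Z\<in>\<Z>. e \<subseteq> Z"
  shows "count_rank \<kappa> V Y \<le> (\<Sum>Z\<in>\<Z>. capacity \<kappa> Z)"
proof -
  obtain F where F: "F \<subseteq> Y" "count_sparse \<kappa> V F" "count_rank \<kappa> V Y = int (card F)"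
    using count_rank_attained[OF Y \<kappa>] .
  show ?thesis unfolding F(3) using F(1,2) Y \<Z> cover by (intro card_le_cover) auto
qed

lemma count_rank_mono:
  assumes "Y' \<subseteq> Y" "Y \<subseteq> E" "1 \<le> \<kappa>"
  shows "count_rank \<kappa> V Y' \<le> count_rank \<kappa> V Y"
proof -
  obtain F where F: "F \<subseteq> Y'" "count_sparse \<kappa> V F" "count_rank \<kappa> V Y' = int (card F)"
    using count_rank_attained[of Y' \<kappa>] assms by auto
  then show ?thesis using card_le_count_rank[of Y F \<kappa>] assms by auto
qed

lemma extend_to_maximal_sparse:
  assumes Y: "Y \<subseteq> E" and I: "I \<subseteq> Y" "count_sparse \<kappa> V I"
  obtains F where "I \<subseteq> F" "F \<subseteq> Y" "count_sparse \<kappa> V F"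
    "\<And>e. e \<in> Y - F \<Longrightarrow> \<not> count_sparse \<kappa> V (insert e F)"
proof -
  from finite_has_maximal2[OF finite_sparse_sets[OF Y, of \<kappa>], of I] I obtain F where
    F: "I \<subseteq> F" "F \<subseteq> Y" "count_sparse \<kappa> V F"
    "\<forall>F'\<in>{F. F \<subseteq> Y \<and> count_sparse \<kappa> V F}. F \<subseteq> F' \<longrightarrow> F = F'" by auto
  then show thesis using that[of F] by blast
qed

text \<open>For submodularity a largest sparse \<open>I \<subseteq> A \<inter> B\<close> is extended
  to a maximal sparse \<open>F \<subseteq> A \<union> B\<close>. The sets
  \<open>F \<inter> A\<close> and \<open>F \<inter> B\<close> are sparse, cover \<open>F\<close> and
  share at least \<open>I\<close>.\<close>

lemma rank_function_count_rank:
  assumes \<kappa>: "1 \<le> \<kappa>"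
  shows "rank_function E (count_rank \<kappa> V)"
  unfolding rank_function_def
proof (intro conjI ballI allI impI)
  show "count_rank \<kappa> V {} = 0" using count_rank_attained[of "{}" \<kappa>] \<kappa> by auto
next
  fix e assume "e \<in> E"
  then have "{e} \<subseteq> E" by simp
  then obtain F where "F \<subseteq> {e}" "count_rank \<kappa> V {e} = int (card F)"
    using count_rank_attained \<kappa> by metis
  then show "count_rank \<kappa> V {e} \<le> 1" using card_mono[of "{e}" F] by auto
next
  fix A B assume AB: "A \<subseteq> E" "B \<subseteq> E"
  then have sub: "A \<inter> B \<subseteq> E" "A \<union> B \<subseteq> E" by auto
  obtain I where I: "I \<subseteq> A \<inter> B" "count_sparse \<kappa> V I" "count_rank \<kappa> V (A \<inter> B) = int (card I)"
    using count_rank_attained[OF sub(1) \<kappa>] .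
  have "I \<subseteq> A \<union> B" using I by auto
  then obtain F where F: "I \<subseteq> F" "F \<subseteq> A \<union> B" "count_sparse \<kappa> V F"
    "\<And>e. e \<in> A \<union> B - F \<Longrightarrow> \<not> count_sparse \<kappa> V (insert e F)"
    using extend_to_maximal_sparse[OF sub(2) _ I(2)] by metis
  have fin: "finite F" using F(2) sub(2) finite_edges by (meson subset_trans)
  have rF: "count_rank \<kappa> V (A \<union> B) = int (card F)"
    by (rule maximal_sparse_card[OF sub(2) \<kappa> F(2,3,4)])
  have "int (card (F \<inter> A)) \<le> count_rank \<kappa> V A" "int (card (F \<inter> B)) \<le> count_rank \<kappa> V B"
    using count_sparse_subset[OF F(3) _ fin] AB by (auto intro: card_le_count_rank)
  moreover have "card (F \<inter> A) + card (F \<inter> B) = card ((F \<inter> A) \<union> (F \<inter> B)) + card ((F \<inter> A) \<inter> (F \<inter> B))"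
    using fin by (intro card_Un_Int) auto
  moreover have "(F \<inter> A) \<union> (F \<inter> B) = F" using F by auto
  moreover have "card I \<le> card ((F \<inter> A) \<inter> (F \<inter> B))" using I F fin by (intro card_mono) auto
  ultimately show "count_rank \<kappa> V (A \<union> B) + count_rank \<kappa> V (A \<inter> B)
      \<le> count_rank \<kappa> V A + count_rank \<kappa> V B"
    using rF I(3) by simp
qed

end


section \<open>Counting edges outside a cover\<close>

definition private_part :: "'a set set \<Rightarrow> 'a set \<Rightarrow> 'a set" where
  "private_part \<Z> Z = Z - \<Union>(\<Z> - {Z})"

lemma private_part_subset: "private_part \<Z> Z \<subseteq> Z"
  by (auto simp: private_part_def)

lemma private_part_disjoint:
  "Z \<in> \<Z> \<Longrightarrow> Z' \<in> \<Z> \<Longrightarrow> Z \<noteq> Z' \<Longrightarrow> private_part \<Z> Z \<inter> private_part \<Z> Z' = {}"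
  by (auto simp: private_part_def)

text \<open>A vertex counts twice in the set to which it is private, and otherwise once in each of the
  at least two sets containing it.\<close>

lemma card_Union_private_part:
  assumes "finite \<Z>" "\<And>Z. Z \<in> \<Z> \<Longrightarrow> finite Z"
  shows "2 * card (\<Union>\<Z>) \<le> (\<Sum>Z\<in>\<Z>. card Z + card (private_part \<Z> Z))"
proof -
  have finU: "finite (\<Union>\<Z>)" using assms by auto
  define w where "w Z u = (of_bool (u \<in> Z) + of_bool (u \<in> private_part \<Z> Z) :: nat)" for Z u
  have "2 \<le> (\<Sum>Z\<in>\<Z>. w Z u)" if u: "u \<in> \<Union>\<Z>" for u
  proof -
    obtain Z where Z: "Z \<in> \<Z>" "u \<in> Z" using u by auto
    show ?thesis
    proof (cases "u \<in> private_part \<Z> Z")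
      case True
      have "w Z u \<le> (\<Sum>Z\<in>\<Z>. w Z u)" using Z assms by (intro member_le_sum) auto
      then show ?thesis using True Z by (simp add: w_def)
    next
      case False
      then obtain Z' where Z': "Z' \<in> \<Z>" "Z' \<noteq> Z" "u \<in> Z'" using Z by (auto simp: private_part_def)
      have "(\<Sum>Z\<in>{Z, Z'}. w Z u) \<le> (\<Sum>Z\<in>\<Z>. w Z u)" using Z Z' assms by (intro sum_mono2) auto
      then show ?thesis using Z Z' by (simp add: w_def)
    qed
  qed
  then have "(\<Sum>u\<in>\<Union>\<Z>. 2) \<le> (\<Sum>u\<in>\<Union>\<Z>. \<Sum>Z\<in>\<Z>. w Z u)" by (rule sum_mono)
  also have "\<dots> = (\<Sum>Z\<in>\<Z>. \<Sum>u\<in>\<Union>\<Z>. w Z u)" by (rule sum.swap)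
  also have "\<dots> = (\<Sum>Z\<in>\<Z>. card Z + card (private_part \<Z> Z))"
  proof (rule sum.cong[OF refl])
    fix Z assume "Z \<in> \<Z>"
    then have "\<Union>\<Z> \<inter> Z = Z" "\<Union>\<Z> \<inter> private_part \<Z> Z = private_part \<Z> Z"
      using private_part_subset[of \<Z> Z] by auto
    then show "(\<Sum>u\<in>\<Union>\<Z>. w Z u) = card Z + card (private_part \<Z> Z)"
      using finU by (simp add: w_def sum.distrib)
  qed
  finally show ?thesis by simp
qed

text \<open>In the application \<open>w u\<close> is the number of edges outside \<open>Y\<close> at
  \<open>u\<close>. Multiplied by \<open>2 * \<kappa> - 1\<close>, the private weight of
  \<open>Z\<close> pays \<open>2 * T * (2 * \<kappa> - 1)\<close> less \<open>T * \<kappa>\<close>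
  per shared vertex. This discount is made good since a shared vertex lies in at least two sets, so
  that the sizes \<open>card Z\<close> overcount the union.\<close>

lemma overlap_counting:
  fixes w :: "'a \<Rightarrow> int" and T \<kappa> :: int
  assumes U: "finite U" and \<Z>: "\<And>Z. Z \<in> \<Z> \<Longrightarrow> Z \<subseteq> U" and \<kappa>: "1 \<le> \<kappa>" "2 * \<kappa> - 1 \<le> T"
    and w: "\<And>u. 0 \<le> w u" and uncovered: "\<And>u. u \<in> U - \<Union>\<Z> \<Longrightarrow> 2 * T \<le> w u"
    and leaving: "\<And>Z. Z \<in> \<Z> \<Longrightarrow> private_part \<Z> Z \<noteq> {} \<Longrightarrow>
      2 * T - \<kappa> * int (card (Z - private_part \<Z> Z)) \<le> (\<Sum>u\<in>private_part \<Z> Z. w u)"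
    and no_private: "\<And>Z. Z \<in> \<Z> \<Longrightarrow> private_part \<Z> Z = {} \<Longrightarrow> 4 \<le> card Z"
  shows "2 * T * (\<kappa> * int (card U) - (2 * \<kappa> - 1) - (\<Sum>Z\<in>\<Z>. capacity \<kappa> Z))
    \<le> (2 * \<kappa> - 1) * (\<Sum>u\<in>U. w u)"
proof -
  have fin: "finite \<Z>" by (rule finite_subset[of _ "Pow U"]) (use U \<Z> in auto)
  have finZ: "finite Z" if "Z \<in> \<Z>" for Z using \<Z>[OF that] U finite_subset by auto
  have sub: "\<Union>\<Z> \<subseteq> U" using \<Z> by auto
  define z where "z Z = int (card (Z - private_part \<Z> Z))" for Z
  have card_private: "int (card Z) = z Z + int (card (private_part \<Z> Z))" if "Z \<in> \<Z>" for Z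
    using card_mono[OF finZ[OF that] private_part_subset[of \<Z> Z]] finZ[OF that]
    by (simp add: z_def card_Diff_subset[OF finite_subset[OF private_part_subset] private_part_subset] of_nat_diff)
  \<comment> \<open>Without private vertices at least four are shared, and
    \<open>4 * T * \<kappa>\<close> is at least \<open>2 * T * (2 * \<kappa> - 1)\<close>. Otherwise
    \<open>2 * \<kappa> - 1 \<le> T\<close> turns the loss
    \<open>(2 * \<kappa> - 1) * \<kappa>\<close> per shared vertex into at most
    \<open>T * \<kappa>\<close>.\<close>
  have per_set: "2 * T * (2 * \<kappa> - 1) - T * \<kappa> * z Z \<le> (2 * \<kappa> - 1) * (\<Sum>u\<in>private_part \<Z> Z. w u)"
    if Z: "Z \<in> \<Z>" for Z
  proof (cases "private_part \<Z> Z = {}")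
    case True
    then have "4 \<le> z Z" using no_private[OF Z] by (simp add: z_def)
    then have "T * \<kappa> * 4 \<le> T * \<kappa> * z Z" using \<kappa> by (intro mult_left_mono) auto
    moreover have "0 \<le> T" using \<kappa> by linarith
    ultimately show ?thesis using True by (simp add: algebra_simps)
  next
    case False
    have "(2 * \<kappa> - 1) * (2 * T - \<kappa> * z Z) \<le> (2 * \<kappa> - 1) * (\<Sum>u\<in>private_part \<Z> Z. w u)"
      using leaving[OF Z False] \<kappa> by (intro mult_left_mono) (auto simp: z_def)
    moreover have "(2 * \<kappa> - 1) * (\<kappa> * z Z) \<le> T * (\<kappa> * z Z)"
      using \<kappa> by (intro mult_right_mono) (auto simp: z_def)
    ultimately show ?thesis by (simp add: algebra_simps)
  qed
  have "(\<Sum>Z\<in>\<Z>. \<Sum>u\<in>private_part \<Z> Z. w u) = (\<Sum>u\<in>(\<Union>Z\<in>\<Z>. private_part \<Z> Z). w u)"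
    by (rule sum.UNION_disjoint[symmetric])
      (use fin finZ in \<open>auto simp: private_part_disjoint intro: finite_subset[OF private_part_subset]\<close>)
  also have "\<dots> \<le> (\<Sum>u\<in>\<Union>\<Z>. w u)"
  proof (rule sum_mono2)
    show "finite (\<Union>\<Z>)" using fin finZ by auto
    show "(\<Union>Z\<in>\<Z>. private_part \<Z> Z) \<subseteq> \<Union>\<Z>" by (auto simp: private_part_def)
  qed (rule w)
  finally have "(2 * \<kappa> - 1) * (\<Sum>Z\<in>\<Z>. \<Sum>u\<in>private_part \<Z> Z. w u) \<le> (2 * \<kappa> - 1) * (\<Sum>u\<in>\<Union>\<Z>. w u)"
    using \<kappa> by (intro mult_left_mono) auto
  moreover have "(\<Sum>Z\<in>\<Z>. 2 * T * (2 * \<kappa> - 1) - T * \<kappa> * z Z)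
      \<le> (2 * \<kappa> - 1) * (\<Sum>Z\<in>\<Z>. \<Sum>u\<in>private_part \<Z> Z. w u)"
    unfolding sum_distrib_left by (rule sum_mono) (use per_set in \<open>simp add: sum_distrib_left\<close>)
  ultimately have covered: "(\<Sum>Z\<in>\<Z>. 2 * T * (2 * \<kappa> - 1) - T * \<kappa> * z Z) \<le> (2 * \<kappa> - 1) * (\<Sum>u\<in>\<Union>\<Z>. w u)"
    by linarith
  \<comment> \<open>An uncovered vertex contributes \<open>2 * T * \<kappa>\<close> on the left and
    at least \<open>2 * T * (2 * \<kappa> - 1)\<close> on the right.\<close>
  define u0 where "u0 = int (card (U - \<Union>\<Z>))"
  have "(\<Sum>u\<in>U - \<Union>\<Z>. 2 * T) \<le> (\<Sum>u\<in>U - \<Union>\<Z>. w u)" using uncovered by (rule sum_mono)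
  then have "(2 * \<kappa> - 1) * (u0 * (2 * T)) \<le> (2 * \<kappa> - 1) * (\<Sum>u\<in>U - \<Union>\<Z>. w u)"
    using \<kappa> by (intro mult_left_mono) (auto simp: u0_def)
  moreover have "\<kappa> * (u0 * (2 * T)) \<le> (2 * \<kappa> - 1) * (u0 * (2 * T))"
    using \<kappa> by (intro mult_right_mono) (auto simp: u0_def)
  ultimately have unc: "\<kappa> * (u0 * (2 * T)) \<le> (2 * \<kappa> - 1) * (\<Sum>u\<in>U - \<Union>\<Z>. w u)" by linarith
  have split: "(\<Sum>u\<in>U. w u) = (\<Sum>u\<in>U - \<Union>\<Z>. w u) + (\<Sum>u\<in>\<Union>\<Z>. w u)"
    using sum.subset_diff[OF sub U, of w] by simp
  have cardU: "int (card U) = u0 + int (card (\<Union>\<Z>))"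
    using card_mono[OF U sub] U sub by (simp add: u0_def card_Diff_subset[OF finite_subset[OF sub U] sub] of_nat_diff)
  have "int (2 * card (\<Union>\<Z>)) \<le> int (\<Sum>Z\<in>\<Z>. card Z + card (private_part \<Z> Z))"
    using card_Union_private_part[OF fin finZ] by (intro of_nat_mono) auto
  also have "\<dots> = (\<Sum>Z\<in>\<Z>. 2 * int (card Z) - z Z)" 
    unfolding of_nat_sum by (rule sum.cong) (auto simp: card_private)
  finally have "T * \<kappa> * (2 * int (card (\<Union>\<Z>))) \<le> T * \<kappa> * (\<Sum>Z\<in>\<Z>. 2 * int (card Z) - z Z)"
    using \<kappa> by (intro mult_left_mono) auto
  moreover have "T * \<kappa> * (\<Sum>Z\<in>\<Z>. 2 * int (card Z) - z Z) - 2 * T * (\<Sum>Z\<in>\<Z>. capacity \<kappa> Z)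
      = (\<Sum>Z\<in>\<Z>. 2 * T * (2 * \<kappa> - 1) - T * \<kappa> * z Z)"
    unfolding sum_distrib_left sum_subtractf[symmetric]
    by (rule sum.cong) (auto simp: capacity_def algebra_simps)
  moreover have "0 \<le> 2 * T * (2 * \<kappa> - 1)" using \<kappa> by auto
  ultimately show ?thesis
    using covered unc unfolding split cardU by (simp add: algebra_simps)
qed

section \<open>Degree sums and orientations\<close>

context simple_edges
begin

lemma sum_degrees:
  assumes "F \<subseteq> E" "X \<subseteq> V"
  shows "(\<Sum>v\<in>X. card {e\<in>F. v \<in> e}) = (\<Sum>e\<in>F. card (e \<inter> X))"
proof -
  have fin: "finite F" "finite X" using assms finite_edges finite_V finite_subset by auto
  have "(\<Sum>v\<in>X. card {e\<in>F. v \<in> e}) = (\<Sum>v\<in>X. \<Sum>e\<in>F. of_bool (v \<in> e))"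
    using fin by (intro sum.cong) (auto simp: Int_def)
  also have "\<dots> = (\<Sum>e\<in>F. \<Sum>v\<in>X. of_bool (v \<in> e))" by (rule sum.swap)
  also have "\<dots> = (\<Sum>e\<in>F. card (e \<inter> X))"
    using fin by (intro sum.cong) (auto simp: Int_commute)
  finally show ?thesis .
qed

lemma card_edge_split:
  assumes "e \<in> E" "U \<subseteq> V"
  shows "card (e \<inter> U) + card (e \<inter> (V - U)) = 2"
proof -
  have "card ((e \<inter> U) \<union> (e \<inter> (V - U))) = card (e \<inter> U) + card (e \<inter> (V - U))"
    using finite_edge[OF assms(1)] by (intro card_Un_disjoint) auto
  moreover have "(e \<inter> U) \<union> (e \<inter> (V - U)) = e" using edge[OF assms(1)] by auto
  ultimately show ?thesis using edge[OF assms(1)] by simp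
qed

lemma card_edge_Int:
  assumes "e \<in> E"
  shows "card (e \<inter> X) \<le> 2" "card (e \<inter> X) = 2 \<longleftrightarrow> e \<subseteq> X" "card (e \<inter> X) = 0 \<longleftrightarrow> e \<inter> X = {}"
proof -
  note e = edge[OF assms] finite_edge[OF assms]
  show "card (e \<inter> X) \<le> 2" using card_mono[of e "e \<inter> X"] e by auto
  show "card (e \<inter> X) = 2 \<longleftrightarrow> e \<subseteq> X"
    using e card_subset_eq[of e "e \<inter> X"] by (metis inf.absorb_iff1 inf_le1)
  show "card (e \<inter> X) = 0 \<longleftrightarrow> e \<inter> X = {}" using e by auto
qed

text \<open>The comparison is made edge by edge: edges inside \<open>U\<close> and outside
  \<open>Y\<close> count two on both sides, edges between \<open>U\<close> and \<open>V - U\<close>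
  count one, and all others zero.\<close>

lemma sum_degrees_outside:
  assumes U: "U \<subseteq> V" and Y: "Y \<subseteq> inside E U"
  shows "(\<Sum>u\<in>U. int (card {e\<in>E - Y. u \<in> e})) \<le>
    2 * int (card (inside E U - Y)) + (\<Sum>v\<in>V - U. int (card {e\<in>E. v \<in> e}))
      - 2 * int (card (inside E (V - U)))"
proof -
  have YE: "Y \<subseteq> E" using Y by (auto simp: inside_def)
  have "(\<Sum>u\<in>U. int (card {e\<in>E - Y. u \<in> e})) = int (\<Sum>e\<in>E - Y. card (e \<inter> U))"
    using sum_degrees[of "E - Y" U] U by (simp flip: of_nat_sum)
  also have "\<dots> = (\<Sum>e\<in>E - Y. int (card (e \<inter> U)))" by simp
  also have "\<dots> = (\<Sum>e\<in>E. if e \<in> Y then 0 else int (card (e \<inter> U)))"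
    using finite_E by (intro sum.mono_neutral_cong_left) auto
  also have "\<dots> \<le> (\<Sum>e\<in>E. 2 * of_bool (e \<in> inside E U - Y) + int (card (e \<inter> (V - U)))
      - 2 * of_bool (e \<in> inside E (V - U)))"
  proof (rule sum_mono)
    fix e assume e: "e \<in> E"
    have ne: "e \<noteq> {}" using edge[OF e] by auto
    have *: "card (e \<inter> U) + card (e \<inter> (V - U)) = 2" using card_edge_split[OF e U] .
    consider "e \<subseteq> U" | "e \<subseteq> V - U" | "\<not> e \<subseteq> U" "\<not> e \<subseteq> V - U" by blast
    then show "(if e \<in> Y then 0 else int (card (e \<inter> U))) \<le>
      2 * of_bool (e \<in> inside E U - Y) + int (card (e \<inter> (V - U)))
      - 2 * of_bool (e \<in> inside E (V - U))"
    proof cases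
      case 1
      then have "\<not> e \<subseteq> V - U" using ne by auto
      then show ?thesis using 1 e * by (auto simp: inside_def)
    next
      case 2
      then have "e \<inter> U = {}" "e \<notin> Y" using ne Y by (auto simp: inside_def)
      then show ?thesis using 2 * e by (simp add: inside_def)
    next
      case 3
      then have "card (e \<inter> U) \<noteq> 2" "card (e \<inter> (V - U)) \<noteq> 2" using card_edge_Int[OF e] by auto
      then have "card (e \<inter> (V - U)) = 1" "card (e \<inter> U) = 1" using * by auto
      then show ?thesis using 3 by (simp add: inside_def)
    qed
  qed
  also have "\<dots> = 2 * int (card (inside E U - Y)) + (\<Sum>e\<in>E. int (card (e \<inter> (V - U))))
      - 2 * int (card (inside E (V - U)))"
  proof -
    have "E \<inter> (inside E U - Y) = inside E U - Y" "E \<inter> inside E (V - U) = inside E (V - U)"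
      by (auto simp: inside_def)
    then show ?thesis
      using finite_E by (simp add: sum.distrib sum_subtractf sum_of_bool_eq Int_def flip: sum_distrib_left)
  qed
  also have "(\<Sum>e\<in>E. int (card (e \<inter> (V - U)))) = (\<Sum>v\<in>V - U. int (card {e\<in>E. v \<in> e}))"
    using sum_degrees[of E "V - U"] by (simp flip: of_nat_sum)
  finally show ?thesis .
qed

text \<open>Hakimi's orientation theorem, by induction on the edges: giving the new edge the head
  \<open>x\<close> costs one unit of \<open>h x\<close>, and one of its two ends can afford
  this.\<close>

lemma orientation:
  fixes h :: "'a \<Rightarrow> int"
  assumes "F \<subseteq> E" "\<And>X. X \<subseteq> V \<Longrightarrow> int (card (inside F X)) \<le> (\<Sum>v\<in>X. h v)"
  shows "\<exists>head. (\<forall>e\<in>F. head e \<in> e) \<and> (\<forall>v\<in>V. int (card {e\<in>F. head e = v}) \<le> h v)"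
proof -
  have "finite F" using assms finite_edges by auto
  then show ?thesis using assms
  proof (induction F arbitrary: h rule: finite_induct)
    case empty
    have "0 \<le> h v" if "v \<in> V" for v using empty.prems(2)[of "{v}"] that by (simp add: inside_def)
    then show ?case by simp
  next
    case (insert e F)
    obtain u w where uw: "e = {u, w}" "u \<noteq> w" using edge[of e] insert.prems(1) by (auto simp: card_2_iff)
    have FE: "F \<subseteq> E" using insert.prems by auto
    have step: "int (card (inside F X)) + of_bool (e \<subseteq> X) \<le> (\<Sum>v\<in>X. h v)" if "X \<subseteq> V" for X
    proof -
      have "inside (insert e F) X = (if e \<subseteq> X then insert e (inside F X) else inside F X)"
        by (auto simp: inside_def)
      moreover have "e \<notin> inside F X" using insert.hyps by (auto simp: inside_def)
      ultimately show ?thesis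
        using insert.prems(2)[OF that] insert.hyps finite_inside[of F X] by (auto split: if_splits)
    qed
    have "\<exists>x\<in>e. \<forall>X\<subseteq>V. int (card (inside F X)) \<le> (\<Sum>v\<in>X. h v) - of_bool (x \<in> X)"
    proof (rule ccontr)
      assume *: "\<not> ?thesis"
      obtain X where X: "X \<subseteq> V" "\<not> int (card (inside F X)) \<le> (\<Sum>v\<in>X. h v) - of_bool (u \<in> X)"
        using * uw by blast
      obtain Y where Y: "Y \<subseteq> V" "\<not> int (card (inside F Y)) \<le> (\<Sum>v\<in>Y. h v) - of_bool (w \<in> Y)"
        using * uw by blast
      \<comment> \<open>Lowering \<open>h\<close> at \<open>u\<close> can only fail on a set that
        contains \<open>u\<close> and has equality, and likewise for \<open>w\<close>. The union of
        the two sets contains \<open>e\<close>, so the edges of \<open>F\<close> stay one below the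
        bound there, against supermodularity.\<close>
      have X': "u \<in> X \<and> (\<Sum>v\<in>X. h v) \<le> int (card (inside F X))"
        using X step[OF X(1)] by (cases "u \<in> X"; cases "e \<subseteq> X") auto
      have Y': "w \<in> Y \<and> (\<Sum>v\<in>Y. h v) \<le> int (card (inside F Y))"
        using Y step[OF Y(1)] by (cases "w \<in> Y"; cases "e \<subseteq> Y") auto
      have "int (card (inside F (X \<union> Y))) + 1 \<le> (\<Sum>v\<in>X \<union> Y. h v)"
        using step[of "X \<union> Y"] X Y X' Y' uw by auto
      moreover have "int (card (inside F (X \<inter> Y))) \<le> (\<Sum>v\<in>X \<inter> Y. h v)"
        using X(1) by (intro order_trans[OF _ step]) auto
      moreover have "(\<Sum>v\<in>X \<union> Y. h v) + (\<Sum>v\<in>X \<inter> Y. h v) = (\<Sum>v\<in>X. h v) + (\<Sum>v\<in>Y. h v)"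
        using X Y finite_V by (intro sum.union_inter) (auto intro: finite_subset)
      ultimately show False
        using X' Y' card_inside_supermodular[OF insert.hyps(1), of X Y] by linarith
    qed
    then obtain x where x: "x \<in> e"
      "\<And>X. X \<subseteq> V \<Longrightarrow> int (card (inside F X)) \<le> (\<Sum>v\<in>X. h v) - of_bool (x \<in> X)" by auto
    have "int (card (inside F X)) \<le> (\<Sum>v\<in>X. (h(x := h x - 1)) v)" if "X \<subseteq> V" for X
    proof -
      have finX: "finite X" using that finite_V finite_subset by auto
      have "(\<Sum>v\<in>X. (h(x := h x - 1)) v) = (\<Sum>v\<in>X. h v - of_bool (v = x))"
        by (intro sum.cong) auto
      also have "\<dots> = (\<Sum>v\<in>X. h v) - of_bool (x \<in> X)"
        using finX by (simp add: sum_subtractf of_bool_def)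
      finally show ?thesis using x(2)[OF that] by simp
    qed
    from insert.IH[OF FE this] obtain head where
      head: "\<forall>e\<in>F. head e \<in> e" "\<forall>v\<in>V. int (card {e\<in>F. head e = v}) \<le> (h(x := h x - 1)) v" by blast
    have "int (card {f\<in>insert e F. (head(e := x)) f = v}) \<le> h v" if "v \<in> V" for v
    proof -
      have "{f\<in>insert e F. (head(e := x)) f = v} =
          (if v = x then insert e {f\<in>F. head f = v} else {f\<in>F. head f = v})"
        using insert.hyps by auto
      then show ?thesis using head(2) that insert.hyps by (auto split: if_splits)
    qed
    moreover have "\<forall>f\<in>insert e F. (head(e := x)) f \<in> f" using head x insert.hyps by auto
    ultimately show ?case by blast
  qed
qed

end


section \<open>Degree constraints\<close>

text \<open>The direct sum of the matroids: the pair \<open>(e, i)\<close> is the copy of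
  \<open>e\<close> offered to the \<open>i\<close>-th one.\<close>

lemma rank_function_sum:
  assumes I: "finite I" and r: "\<And>i. i \<in> I \<Longrightarrow> rank_function E (r i)"
  shows "rank_function (E \<times> I) (\<lambda>W. \<Sum>i\<in>I. r i {e. (e, i) \<in> W})"
  unfolding rank_function_def
proof (intro conjI ballI allI impI)
  have r0: "r i {} = 0" if "i \<in> I" for i using r[OF that] by (simp add: rank_function_def)
  show "(\<Sum>i\<in>I. r i {e. (e, i) \<in> {}}) = 0" using r0 by simp
  fix x assume "x \<in> E \<times> I"
  then obtain e j where x: "x = (e, j)" "e \<in> E" "j \<in> I" by auto
  have "(\<Sum>i\<in>I. r i {e. (e, i) \<in> {x}}) = (\<Sum>i\<in>I. if i = j then r j {e} else 0)"
    using x r0 by (intro sum.cong) auto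
  also have "\<dots> = r j {e}" using x I by simp
  also have "\<dots> \<le> 1" using r[OF x(3)] x(2) by (simp add: rank_function_def)
  finally show "(\<Sum>i\<in>I. r i {e. (e, i) \<in> {x}}) \<le> 1" .
next
  fix X Y assume XY: "X \<subseteq> E \<times> I" "Y \<subseteq> E \<times> I"
  have "r i {e. (e, i) \<in> X \<union> Y} + r i {e. (e, i) \<in> X \<inter> Y} \<le> r i {e. (e, i) \<in> X} + r i {e. (e, i) \<in> Y}"
    if "i \<in> I" for i
  proof -
    have "r i ({e. (e, i) \<in> X} \<union> {e. (e, i) \<in> Y}) + r i ({e. (e, i) \<in> X} \<inter> {e. (e, i) \<in> Y})
        \<le> r i {e. (e, i) \<in> X} + r i {e. (e, i) \<in> Y}"
      using XY by (intro rank_function_submodular[OF r[OF that]]) auto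
    then show ?thesis by (simp add: Collect_disj_eq Collect_conj_eq)
  qed
  then show "(\<Sum>i\<in>I. r i {e. (e, i) \<in> X \<union> Y}) + (\<Sum>i\<in>I. r i {e. (e, i) \<in> X \<inter> Y})
      \<le> (\<Sum>i\<in>I. r i {e. (e, i) \<in> X}) + (\<Sum>i\<in>I. r i {e. (e, i) \<in> Y})"
    unfolding sum.distrib[symmetric] by (rule sum_mono)
qed

lemma rank_function_fst:
  assumes r: "rank_function E r" and mono: "\<And>X Y. X \<subseteq> Y \<Longrightarrow> Y \<subseteq> E \<Longrightarrow> r X \<le> r Y"
  shows "rank_function (E \<times> I) (\<lambda>W. r (fst ` W))"
  unfolding rank_function_def
proof (intro conjI ballI allI impI)
  show "r (fst ` {}) = 0" using r by (simp add: rank_function_def)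
  show "r (fst ` {x}) \<le> 1" if "x \<in> E \<times> I" for x using r that by (auto simp: rank_function_def)
  fix X Y :: "('a \<times> 'b) set" assume XY: "X \<subseteq> E \<times> I" "Y \<subseteq> E \<times> I"
  then have sub: "fst ` X \<subseteq> E" "fst ` Y \<subseteq> E" by auto
  have "r (fst ` (X \<inter> Y)) \<le> r (fst ` X \<inter> fst ` Y)" using sub by (intro mono) auto
  then show "r (fst ` (X \<union> Y)) + r (fst ` (X \<inter> Y)) \<le> r (fst ` X) + r (fst ` Y)"
    using rank_function_submodular[OF r sub] by (simp add: image_Un)
qed

text \<open>This is the rank function of the sets \<open>F\<close> for which at most \<open>b X\<close> edges of \<open>F\<close> meet \<open>X\<close>,
  for every vertex set \<open>X\<close>.\<close>

definition touch_rank :: "'a set \<Rightarrow> ('a set \<Rightarrow> int) \<Rightarrow> 'a set set \<Rightarrow> int" where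
  "touch_rank V b Y = Min ((\<lambda>X. b X + int (card {e\<in>Y. e \<inter> X = {}})) ` Pow V)"

text \<open>For \<open>g v \<ge> d v / 2\<close>, the edges outside \<open>F\<close> can be oriented so that every in-degree is at most
  \<open>g v - d\<^sub>F v\<close> iff at most \<open>degree_slack E g X\<close> edges of \<open>F\<close> meet \<open>X\<close>, for every \<open>X\<close>.\<close>

definition degree_slack :: "'a set set \<Rightarrow> ('a \<Rightarrow> int) \<Rightarrow> 'a set \<Rightarrow> int" where
  "degree_slack E g X = (\<Sum>v\<in>X. g v) - int (card (inside E X))"

context simple_edges
begin

lemma touch_rank_le:
  assumes "X \<subseteq> V"
  shows "touch_rank V b Y \<le> b X + int (card {e\<in>Y. e \<inter> X = {}})"
  unfolding touch_rank_def using assms finite_V by (intro Min_le) auto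

lemma touch_rank_attained:
  obtains X where "X \<subseteq> V" "touch_rank V b Y = b X + int (card {e\<in>Y. e \<inter> X = {}})"
proof -
  have "touch_rank V b Y \<in> (\<lambda>X. b X + int (card {e\<in>Y. e \<inter> X = {}})) ` Pow V"
    unfolding touch_rank_def using finite_V by (intro Min_in) auto
  then show thesis using that by auto
qed

lemma touch_rank_mono:
  assumes "Y \<subseteq> Y'" "Y' \<subseteq> E"
  shows "touch_rank V b Y \<le> touch_rank V b Y'"
proof -
  obtain X where X: "X \<subseteq> V" "touch_rank V b Y' = b X + int (card {e\<in>Y'. e \<inter> X = {}})"
    using touch_rank_attained .
  have "card {e\<in>Y. e \<inter> X = {}} \<le> card {e\<in>Y'. e \<inter> X = {}}"
    using assms finite_edges by (intro card_mono) auto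
  then show ?thesis using touch_rank_le[OF X(1), of b Y] X(2) by linarith
qed

text \<open>Minimizers \<open>X\<close> for \<open>A\<close> and \<open>Y\<close> for
  \<open>B\<close> are uncrossed to \<open>X \<union> Y\<close> for \<open>A \<union> B\<close> and
  \<open>X \<inter> Y\<close> for \<open>A \<inter> B\<close>. The only edges newly counted join
  \<open>X - Y\<close> to \<open>Y - X\<close>, and the assumption on \<open>b\<close> pays for
  them.\<close>

lemma rank_function_touch_rank:
  assumes b: "b {} = 0" "\<And>X. X \<subseteq> V \<Longrightarrow> 0 \<le> b X"
    and sub: "\<And>X Y. X \<subseteq> V \<Longrightarrow> Y \<subseteq> V \<Longrightarrow>
      b (X \<union> Y) + b (X \<inter> Y) + int (card {e\<in>E. e \<inter> (X - Y) \<noteq> {} \<and> e \<inter> (Y - X) \<noteq> {}}) \<le> b X + b Y"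
  shows "rank_function E (touch_rank V b)"
  unfolding rank_function_def
proof (intro conjI ballI allI impI)
  obtain X where X: "X \<subseteq> V" "touch_rank V b {} = b X + int (card {e\<in>{}. e \<inter> X = {}})"
    using touch_rank_attained .
  have "touch_rank V b {} \<le> 0" using touch_rank_le[of "{}" b "{}"] b(1) by simp
  then show "touch_rank V b {} = 0" using b(2)[OF X(1)] X(2) by simp
  show "touch_rank V b {e} \<le> 1" if "e \<in> E" for e
    using touch_rank_le[of "{}" b "{e}"] b by simp
next
  fix A B assume AB: "A \<subseteq> E" "B \<subseteq> E"
  obtain X where X: "X \<subseteq> V" "touch_rank V b A = b X + int (card {e\<in>A. e \<inter> X = {}})"
    using touch_rank_attained .
  obtain Y where Y: "Y \<subseteq> V" "touch_rank V b B = b Y + int (card {e\<in>B. e \<inter> Y = {}})"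
    using touch_rank_attained .
  define P where "P = {e\<in>A. e \<inter> X = {}}"
  define Q where "Q = {e\<in>B. e \<inter> Y = {}}"
  define C where "C = {e\<in>E. e \<inter> (X - Y) \<noteq> {} \<and> e \<inter> (Y - X) \<noteq> {}}"
  define L where "L = {e\<in>A \<union> B. e \<inter> (X \<union> Y) = {}}"
  define M where "M = {e\<in>A \<inter> B. e \<inter> (X \<inter> Y) = {}}"
  have fin: "finite P" "finite Q" "finite C" "finite L" "finite M"
    using AB by (auto intro!: finite_edges simp: P_def Q_def C_def L_def M_def)
  have "card L + card M = card (L \<union> M) + card (L \<inter> M)" using fin by (intro card_Un_Int)
  moreover have "card P + card Q = card (P \<union> Q) + card (P \<inter> Q)" using fin by (intro card_Un_Int)
  moreover have "card (L \<inter> M) \<le> card (P \<inter> Q)"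
    using fin by (intro card_mono) (auto simp: P_def Q_def L_def M_def)
  moreover have "L \<union> M \<subseteq> (P \<union> Q) \<union> C"
    using AB unfolding P_def Q_def C_def L_def M_def by blast
  then have "card (L \<union> M) \<le> card ((P \<union> Q) \<union> C)" using fin by (intro card_mono) auto
  moreover have "card ((P \<union> Q) \<union> C) \<le> card (P \<union> Q) + card C" by (rule card_Un_le)
  ultimately have "card L + card M \<le> card P + card Q + card C" by linarith
  moreover have "touch_rank V b (A \<union> B) \<le> b (X \<union> Y) + int (card L)"
    unfolding L_def using X Y by (intro touch_rank_le) auto
  moreover have "touch_rank V b (A \<inter> B) \<le> b (X \<inter> Y) + int (card M)"
    unfolding M_def using X by (intro touch_rank_le) auto
  moreover have "b (X \<union> Y) + b (X \<inter> Y) + int (card C) \<le> b X + b Y"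
    unfolding C_def using X(1) Y(1) by (rule sub)
  ultimately show "touch_rank V b (A \<union> B) + touch_rank V b (A \<inter> B) \<le> touch_rank V b A + touch_rank V b B"
    unfolding X(2) Y(2) P_def[symmetric] Q_def[symmetric] by linarith
qed

text \<open>Edges between \<open>X - Y\<close> and \<open>Y - X\<close> lie inside
  \<open>X \<union> Y\<close> but inside neither set, which gives the extra term in the
  submodularity. Nonnegativity holds because \<open>2 * g\<close> dominates the degrees.\<close>

lemma rank_function_degree_slack:
  assumes g: "\<And>v. v \<in> V \<Longrightarrow> int (card {e\<in>E. v \<in> e}) \<le> 2 * g v"
  shows "rank_function E (touch_rank V (degree_slack E g))"
proof (rule rank_function_touch_rank)
  have "inside E {} = {}" by (rule inside_small) auto
  then show "degree_slack E g {} = 0" by (simp add: degree_slack_def)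
next
  fix X assume X: "X \<subseteq> V"
  have "(\<Sum>e\<in>E. 2 * of_bool (e \<subseteq> X)) \<le> (\<Sum>e\<in>E. card (e \<inter> X))"
    by (rule sum_mono) (use edge in \<open>auto simp: Int_absorb2\<close>)
  then have "2 * card (inside E X) \<le> (\<Sum>e\<in>E. card (e \<inter> X))"
    using finite_E by (simp add: inside_def Int_def flip: sum_distrib_left)
  also have "\<dots> = (\<Sum>v\<in>X. card {e\<in>E. v \<in> e})" using sum_degrees[of E X] X by simp
  finally have "2 * int (card (inside E X)) \<le> (\<Sum>v\<in>X. int (card {e\<in>E. v \<in> e}))"
    using of_nat_mono by fastforce
  also have "\<dots> \<le> (\<Sum>v\<in>X. 2 * g v)" using g X by (intro sum_mono) auto
  finally show "0 \<le> degree_slack E g X" by (simp add: degree_slack_def flip: sum_distrib_left)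
next
  fix X Y assume XY: "X \<subseteq> V" "Y \<subseteq> V"
  define C where "C = {e\<in>E. e \<inter> (X - Y) \<noteq> {} \<and> e \<inter> (Y - X) \<noteq> {}}"
  have fin: "finite (inside E A)" "finite C" for A using finite_E by (auto simp: inside_def C_def)
  have "C \<subseteq> inside E (X \<union> Y)"
  proof
    fix e assume e: "e \<in> C"
    then obtain x y where "x \<in> e" "x \<in> X - Y" "y \<in> e" "y \<in> Y - X" by (auto simp: C_def)
    moreover have "e \<in> E" using e by (simp add: C_def)
    moreover obtain u w where "e = {u, w}" using edge[OF \<open>e \<in> E\<close>] by (auto simp: card_2_iff)
    ultimately show "e \<in> inside E (X \<union> Y)" by (auto simp: inside_def)
  qed
  then have "(inside E X \<union> inside E Y) \<union> C \<subseteq> inside E (X \<union> Y)" by (auto simp: inside_def)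
  then have "card ((inside E X \<union> inside E Y) \<union> C) \<le> card (inside E (X \<union> Y))"
    using fin by (intro card_mono) auto
  moreover have "card ((inside E X \<union> inside E Y) \<union> C) = card (inside E X \<union> inside E Y) + card C"
    using fin by (intro card_Un_disjoint) (auto simp: inside_def C_def)
  moreover have "card (inside E X) + card (inside E Y)
      = card (inside E X \<union> inside E Y) + card (inside E X \<inter> inside E Y)"
    using fin by (intro card_Un_Int) auto
  moreover have "inside E X \<inter> inside E Y = inside E (X \<inter> Y)" by (auto simp: inside_def)
  ultimately have "int (card (inside E X)) + int (card (inside E Y)) + int (card C)
      \<le> int (card (inside E (X \<union> Y))) + int (card (inside E (X \<inter> Y)))" by simp
  moreover have "(\<Sum>v\<in>X \<union> Y. g v) + (\<Sum>v\<in>X \<inter> Y. g v) = (\<Sum>v\<in>X. g v) + (\<Sum>v\<in>Y. g v)"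
    using XY finite_V by (intro sum.union_inter) (auto intro: finite_subset)
  ultimately show "degree_slack E g (X \<union> Y) + degree_slack E g (X \<inter> Y)
      + int (card {e\<in>E. e \<inter> (X - Y) \<noteq> {} \<and> e \<inter> (Y - X) \<noteq> {}}) \<le> degree_slack E g X + degree_slack E g Y"
    unfolding degree_slack_def C_def[symmetric] by linarith
qed

end

section \<open>Weakly connected graphs\<close>

locale weakly_connected_edges = simple_edges V E for V :: "'a set" and E :: "'a set set" +
  fixes k p m :: nat
  assumes k: "2 \<le> k" and card_V: "2 \<le> card V"
    and weakly_connected: "\<And>A B. A \<inter> B = {} \<Longrightarrow> A \<noteq> {} \<Longrightarrow> A \<union> B \<subset> V \<Longrightarrow>
      2 * ((2 * int k - 1) * int p + int m) - int k * int (card B)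
        \<le> int (card {e\<in>E. e \<inter> B = {} \<and> card (e \<inter> A) = 1})"
begin

text \<open>Over the \<open>m\<close> trees and \<open>p\<close> rigid graphs, \<open>c\<close> is
  the sum of the \<open>\<kappa>\<close> and \<open>T\<close> that of the constants
  \<open>2 * \<kappa> - 1\<close>, so the capacities of \<open>V\<close> sum to
  \<open>c * int (card V) - T\<close>.\<close>

definition T :: int where "T = (2 * int k - 1) * int p + int m"

definition c :: int where "c = int k * int p + int m"

text \<open>The division rounds half the degree up. The value will bound the in-degree outside
  \<open>F\<close> plus the degree in \<open>F\<close>.\<close>

definition g :: "'a \<Rightarrow> int" where "g v = (int (card {e\<in>E. v \<in> e}) + 1) div 2 + c"

lemma c_nonneg: "0 \<le> c"
  by (simp add: c_def)

lemma degree_ge: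
  assumes "v \<in> V"
  shows "2 * T \<le> int (card {e\<in>E. v \<in> e})"
proof -
  have "{v} \<noteq> V" using card_V by auto
  then have "2 * T \<le> int (card {e\<in>E. e \<inter> {} = {} \<and> card (e \<inter> {v}) = 1})"
    using weakly_connected[of "{v}" "{}"] assms by (auto simp: T_def)
  moreover have "{e\<in>E. e \<inter> {} = {} \<and> card (e \<inter> {v}) = 1} = {e\<in>E. v \<in> e}"
    by (auto simp: Int_insert_right split: if_splits)
  ultimately show ?thesis by simp
qed

text \<open>This is \<open>overlap_counting\<close> for the edges outside \<open>Y\<close>. Weak
  connectivity is applied to the private vertices \<open>A\<close> of \<open>Z\<close> with its
  shared vertices \<open>B\<close> deleted. The alternatives in \<open>kind\<close> serve the rigid
  graphs and the trees; in the second one \<open>B\<close> is empty.\<close>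

lemma cover_bound:
  assumes Y: "Y \<subseteq> inside E U" and U: "U \<subseteq> V" and \<kappa>: "1 \<le> \<kappa>" "2 * \<kappa> - 1 \<le> T"
    and \<Z>: "\<And>Z. Z \<in> \<Z> \<Longrightarrow> Z \<subseteq> V \<and> 2 \<le> card Z"
    and vertex: "\<And>Z v. Z \<in> \<Z> \<Longrightarrow> v \<in> Z \<Longrightarrow> \<exists>e\<in>Y. v \<in> e \<and> e \<subseteq> Z"
    and cover: "\<And>e. e \<in> Y \<Longrightarrow> \<exists>Z\<in>\<Z>. e \<subseteq> Z"
    and kind: "\<kappa> = int k \<and> (\<forall>Z\<in>\<Z>. 4 \<le> card Z) \<or> (\<forall>Z\<in>\<Z>. private_part \<Z> Z = Z)"
  shows "2 * T * (\<kappa> * int (card U) - (2 * \<kappa> - 1) - (\<Sum>Z\<in>\<Z>. capacity \<kappa> Z))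
    \<le> (2 * \<kappa> - 1) * (\<Sum>u\<in>U. int (card {e\<in>E - Y. u \<in> e}))"
proof (cases "V \<in> \<Z>")
  \<comment> \<open>Weak connectivity needs \<open>Z \<noteq> V\<close>. If \<open>V\<close> is in
    the cover, its capacity alone makes the left side nonpositive.\<close>
  case True
  have ZU: "Z \<subseteq> U" if "Z \<in> \<Z>" for Z using vertex[OF that] Y by (force simp: inside_def)
  have UV: "U = V" using ZU[OF True] U by auto
  have fin: "finite \<Z>" by (rule finite_subset[of _ "Pow V"]) (use finite_V \<Z> in auto)
  have "capacity \<kappa> V \<le> (\<Sum>Z\<in>\<Z>. capacity \<kappa> Z)"
    using True fin \<Z> capacity_nonneg \<kappa> by (intro member_le_sum) auto
  then have "\<kappa> * int (card U) - (2 * \<kappa> - 1) - (\<Sum>Z\<in>\<Z>. capacity \<kappa> Z) \<le> 0"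
    by (simp add: capacity_def UV)
  then have "2 * T * (\<kappa> * int (card U) - (2 * \<kappa> - 1) - (\<Sum>Z\<in>\<Z>. capacity \<kappa> Z)) \<le> 0"
    using \<kappa> by (intro mult_nonneg_nonpos) auto
  also have "0 \<le> (2 * \<kappa> - 1) * (\<Sum>u\<in>U. int (card {e\<in>E - Y. u \<in> e}))"
    using \<kappa> by (intro mult_nonneg_nonneg sum_nonneg) auto
  finally show ?thesis .
next
  case False
  have ZU: "Z \<subseteq> U" if "Z \<in> \<Z>" for Z using vertex[OF that] Y by (force simp: inside_def)
  show ?thesis
  proof (rule overlap_counting[OF _ ZU \<kappa>])
    show "finite U" using U finite_V finite_subset by auto
    show "0 \<le> int (card {e\<in>E - Y. u \<in> e})" for u by simp
  next
    fix u assume u: "u \<in> U - \<Union>\<Z>"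
    then have "{e\<in>E - Y. u \<in> e} = {e\<in>E. u \<in> e}" using cover by blast
    then show "2 * T \<le> int (card {e\<in>E - Y. u \<in> e})" using degree_ge[of u] u U by auto
  next
    fix Z assume Z: "Z \<in> \<Z>" and ne: "private_part \<Z> Z \<noteq> {}"
    define A where "A = private_part \<Z> Z"
    define B where "B = Z - private_part \<Z> Z"
    have AB: "A \<inter> B = {}" "A \<union> B = Z" using private_part_subset[of \<Z> Z] by (auto simp: A_def B_def)
    have finA: "finite A" using AB(2) \<Z>[OF Z] finite_V finite_subset by blast
    have "Z \<subset> V" using \<Z>[OF Z] Z False by auto
    then have "2 * T - int k * int (card B) \<le> int (card {e\<in>E. e \<inter> B = {} \<and> card (e \<inter> A) = 1})"
      using weakly_connected[of A B] AB ne unfolding A_def[symmetric] T_def by simp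
    moreover have "\<kappa> * int (card B) = int k * int (card B)"
      using kind Z by (auto simp: B_def)
    moreover have "{e\<in>E. e \<inter> B = {} \<and> card (e \<inter> A) = 1} \<subseteq> (\<Union>u\<in>A. {e\<in>E - Y. u \<in> e})"
    proof
      fix e assume "e \<in> {e\<in>E. e \<inter> B = {} \<and> card (e \<inter> A) = 1}"
      then have e: "e \<in> E" "e \<inter> B = {}" "card (e \<inter> A) = 1" by auto
      then obtain u where u: "e \<inter> A = {u}" using card_1_singletonE by blast
      \<comment> \<open>A covering set that contains \<open>e\<close> contains the private vertex
        \<open>u\<close>, hence is \<open>Z\<close>. As \<open>e\<close> avoids \<open>B\<close>,
        both its ends would lie in \<open>A\<close>.\<close>
      have "e \<notin> Y"
      proof
        assume "e \<in> Y"
        then obtain Z' where Z': "Z' \<in> \<Z>" "e \<subseteq> Z'" using cover by blast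
        then have "Z' = Z" using u by (auto simp: A_def private_part_def)
        then have "e \<subseteq> A" using Z' e(2) AB by auto
        then have "e = {u}" using u by auto
        then show False using edge[OF e(1)] by simp
      qed
      then show "e \<in> (\<Union>u\<in>A. {e\<in>E - Y. u \<in> e})" using u e by auto
    qed
    then have "card {e\<in>E. e \<inter> B = {} \<and> card (e \<inter> A) = 1} \<le> (\<Sum>u\<in>A. card {e\<in>E - Y. u \<in> e})"
      using finA finite_E by (intro order_trans[OF card_mono card_UN_le[OF finA]]) auto
    then have "int (card {e\<in>E. e \<inter> B = {} \<and> card (e \<inter> A) = 1}) \<le> (\<Sum>u\<in>A. int (card {e\<in>E - Y. u \<in> e}))"
      by (simp flip: of_nat_sum)
    ultimately show "2 * T - \<kappa> * int (card (Z - private_part \<Z> Z))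
        \<le> (\<Sum>u\<in>private_part \<Z> Z. int (card {e\<in>E - Y. u \<in> e}))"
      unfolding A_def B_def by linarith
  next
    fix Z assume "Z \<in> \<Z>" "private_part \<Z> Z = {}"
    then show "4 \<le> card Z" using kind \<Z>[of Z] by auto
  qed
qed

text \<open>The capacity is 1 on two vertices and \<open>k + 1\<close>, at least 3, on three: no
  less than the number of edges of a complete graph.\<close>

lemma card_inside_small:
  assumes "Z \<subseteq> V" "2 \<le> card Z" "card Z \<le> 3" "Y \<subseteq> E"
  shows "int (card (inside Y Z)) \<le> capacity (int k) Z"
proof -
  have finZ: "finite Z" using assms finite_V finite_subset by auto
  have "inside Y Z \<subseteq> {e. e \<subseteq> Z \<and> card e = 2}" using edge assms by (auto simp: inside_def)
  then have "card (inside Y Z) \<le> card Z choose 2"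
    using card_mono[of "{e. e \<subseteq> Z \<and> card e = 2}"] n_subsets[OF finZ, of 2] finZ by auto
  moreover have "card Z = 2 \<or> card Z = 3" using assms by auto
  ultimately show ?thesis using k by (auto simp: capacity_def numeral_eq_Suc)
qed

text \<open>A set with at most three vertices spans no more edges than its capacity, so deleting these
  edges from \<open>Y\<close> does not increase the right-hand side. All remaining sets have at least four
  vertices, which is what the counting needs of sets without private vertices.\<close>

lemma rank_bound:
  assumes U: "U \<subseteq> V" and "Y \<subseteq> inside E U"
  shows "c * int (card V) - T \<le> int p * count_rank (int k) V Y + int m * count_rank 1 V Y
    + int (card (inside E U - Y)) + degree_slack E g (V - U)"
proof -
  have "finite Y" using assms finite_edges inside_subset by (meson subset_trans)
  then show ?thesis using assms(2)
  proof (induction Y rule: finite_psubset_induct)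
    case (psubset Y)
    note Y = psubset.prems
    have YE: "Y \<subseteq> E" using Y inside_subset by auto
    have k1: "1 \<le> int k" using k by auto
    obtain \<Z> where \<Z>: "\<And>Z. Z \<in> \<Z> \<Longrightarrow> Z \<subseteq> V \<and> 2 \<le> card Z"
      "\<And>Z v. Z \<in> \<Z> \<Longrightarrow> v \<in> Z \<Longrightarrow> \<exists>e\<in>Y. v \<in> e \<and> e \<subseteq> Z" "\<And>e. e \<in> Y \<Longrightarrow> \<exists>Z\<in>\<Z>. e \<subseteq> Z"
      "count_rank (int k) V Y = (\<Sum>Z\<in>\<Z>. capacity (int k) Z)"
      using count_rank_cover[OF YE k1] by metis
    have fin\<Z>: "finite \<Z>" by (rule finite_subset[of _ "Pow V"]) (use finite_V \<Z> in auto)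
    show ?case
    proof (cases "p \<noteq> 0 \<and> (\<exists>Z\<in>\<Z>. card Z \<le> 3)")
      case True
      then obtain Z where Z: "Z \<in> \<Z>" "card Z \<le> 3" by auto
      let ?Y = "Y - inside Y Z"
      have "Z \<noteq> {}" using \<Z>(1)[OF Z(1)] by auto
      then have "inside Y Z \<noteq> {}" using \<Z>(2)[OF Z(1)] by (force simp: inside_def)
      then have "?Y \<subset> Y" using inside_subset[of Y Z] by auto
      then have IH: "c * int (card V) - T \<le> int p * count_rank (int k) V ?Y + int m * count_rank 1 V ?Y
        + int (card (inside E U - ?Y)) + degree_slack E g (V - U)"
        using Y by (intro psubset.IH) auto
      have "count_rank (int k) V ?Y \<le> (\<Sum>Z\<in>\<Z> - {Z}. capacity (int k) Z)"
      proof (rule count_rank_le_cover[OF _ k1])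
        show "?Y \<subseteq> E" using YE by auto
        show "Z' \<subseteq> V \<and> 2 \<le> card Z'" if "Z' \<in> \<Z> - {Z}" for Z' using \<Z>(1) that by auto
        show "\<exists>Z'\<in>\<Z> - {Z}. e \<subseteq> Z'" if "e \<in> ?Y" for e
          using \<Z>(3)[of e] that by (auto simp: inside_def)
      qed
      also have "\<dots> = count_rank (int k) V Y - capacity (int k) Z"
        using Z fin\<Z> by (simp add: \<Z>(4) sum_diff1)
      finally have "int p * count_rank (int k) V ?Y \<le> int p * (count_rank (int k) V Y - capacity (int k) Z)"
        by (intro mult_left_mono) auto
      moreover have "capacity (int k) Z \<le> int p * capacity (int k) Z"
        using mult_right_mono[of 1 "int p" "capacity (int k) Z"] True capacity_nonneg[OF k1] \<Z>(1)[OF Z(1)] by auto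
      moreover have "int m * count_rank 1 V ?Y \<le> int m * count_rank 1 V Y"
        using YE by (intro mult_left_mono count_rank_mono) auto
      moreover have "int (card (inside E U - ?Y)) \<le> int (card (inside E U - Y)) + capacity (int k) Z"
      proof -
        have "inside E U - ?Y \<subseteq> (inside E U - Y) \<union> inside Y Z" by auto
        then have "card (inside E U - ?Y) \<le> card ((inside E U - Y) \<union> inside Y Z)"
          using finite_E finite_edges[OF YE] by (intro card_mono) (auto simp: finite_inside)
        also have "\<dots> \<le> card (inside E U - Y) + card (inside Y Z)" by (rule card_Un_le)
        finally show ?thesis using card_inside_small[of Z Y] \<Z>(1)[OF Z(1)] Z YE by auto
      qed
      ultimately show ?thesis using IH by (simp add: right_diff_distrib)
    next
      case False
      define Q where "Q = (\<Sum>u\<in>U. int (card {e\<in>E - Y. u \<in> e}))"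
      \<comment> \<open>How far the ranks of \<open>Y\<close> fall short of the full ranks on
        \<open>U\<close>, for the rigid graphs and for the trees.\<close>
      define xk where "xk = int k * int (card U) - (2 * int k - 1) - count_rank (int k) V Y"
      define x1 where "x1 = int (card U) - 1 - count_rank 1 V Y"
      have Q0: "0 \<le> Q" unfolding Q_def by (intro sum_nonneg) auto
      have rigid_part: "int p * (2 * T * xk) \<le> int p * ((2 * int k - 1) * Q)"
      proof (cases "p = 0")
        case p: False
        have "(2 * int k - 1) * 1 \<le> (2 * int k - 1) * int p" using p k by (intro mult_left_mono) auto
        then have kT: "2 * int k - 1 \<le> T" unfolding T_def by (simp add: trans_le_add1 add_increasing2)
        have "4 \<le> card Z" if "Z \<in> \<Z>" for Z
        proof -
          have "\<not> card Z \<le> 3" using p False that by blast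
          then show ?thesis by linarith
        qed
        then have "2 * T * xk \<le> (2 * int k - 1) * Q"
          unfolding xk_def Q_def \<Z>(4) by (intro cover_bound[OF Y U k1 kT \<Z>(1,2,3)]) auto
        then show ?thesis by (intro mult_left_mono) auto
      qed auto
      have tree_part: "int m * (2 * T * x1) \<le> int m * Q"
      proof (cases "m = 0")
        case m: False
        obtain \<W> where \<W>: "\<And>Z. Z \<in> \<W> \<Longrightarrow> Z \<subseteq> V \<and> 2 \<le> card Z"
          "\<And>Z v. Z \<in> \<W> \<Longrightarrow> v \<in> Z \<Longrightarrow> \<exists>e\<in>Y. v \<in> e \<and> e \<subseteq> Z"
          "pairwise disjnt \<W>"
          "\<And>e. e \<in> Y \<Longrightarrow> \<exists>Z\<in>\<W>. e \<subseteq> Z" "count_rank 1 V Y = (\<Sum>Z\<in>\<W>. capacity 1 Z)"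
          using count_rank_cover[OF YE order_refl] by metis
        have disjoint: "\<forall>Z\<in>\<W>. private_part \<W> Z = Z"
          using \<W>(3) unfolding private_part_def pairwise_def disjnt_def by blast
        have "0 \<le> (2 * int k - 1) * int p" using k by simp
        then have T1: "2 * 1 - 1 \<le> T" using m unfolding T_def by linarith
        have "2 * T * (1 * int (card U) - (2 * 1 - 1) - (\<Sum>Z\<in>\<W>. capacity 1 Z)) \<le> (2 * 1 - 1) * Q"
          unfolding Q_def by (rule cover_bound[OF Y U order_refl T1 \<W>(1,2,4) disjI2[OF disjoint]])
        then show ?thesis unfolding x1_def \<W>(5) by (intro mult_left_mono) auto
      qed auto
      have "2 * (int p * xk + int m * x1) \<le> Q"
      proof (cases "T = 0")
        case True
        then have "p = 0" "m = 0" using k by (auto simp: T_def add_nonneg_eq_0_iff)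
        then show ?thesis using Q0 by simp
      next
        case False
        moreover have "0 \<le> (2 * int k - 1) * int p" using k by simp
        ultimately have T: "0 < T" unfolding T_def by linarith
        \<comment> \<open>The factors \<open>p * (2 * k - 1)\<close> and \<open>m\<close> of
          \<open>Q\<close> in the two parts add up to \<open>T\<close>, which then cancels.\<close>
        have "T * (2 * (int p * xk + int m * x1)) \<le> T * Q"
          using rigid_part tree_part by (simp add: T_def algebra_simps)
        then show ?thesis using T by simp
      qed
      \<comment> \<open>By the choice of \<open>g\<close> each degree is at most
        \<open>2 * g v - 2 * c\<close>; this turns the degree sum over \<open>V - U\<close> into the
        slack.\<close>
      moreover have "Q \<le> 2 * int (card (inside E U - Y)) + 2 * degree_slack E g (V - U) - 2 * (c * int (card (V - U)))"
      proof -
        have "(\<Sum>v\<in>V - U. int (card {e\<in>E. v \<in> e})) \<le> (\<Sum>v\<in>V - U. 2 * g v - 2 * c)"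
          by (intro sum_mono) (auto simp: g_def)
        then show ?thesis using sum_degrees_outside[OF U Y]
          by (simp add: Q_def degree_slack_def sum_subtractf algebra_simps flip: sum_distrib_left)
      qed
      moreover have "int (card V) = int (card U) + int (card (V - U))"
        using card_Un_disjoint[of U "V - U"] U finite_V finite_subset[OF U] by (auto simp: Un_absorb1)
      ultimately show ?thesis
        by (simp add: xk_def x1_def c_def T_def algebra_simps)
    qed
  qed
qed

end


section \<open>Disjoint subsets; cuts, trees and rigidity from sparse sets of full size\<close>

lemma disjoint_subsets_of_card:
  assumes "finite A" "a * q \<le> card A"
  shows "\<exists>P. (\<forall>j<q. P j \<subseteq> A \<and> card (P j) = a) \<and> disjoint_family_on P {..<q}"
  using assms(2)
proof (induction q)
  case 0
  then show ?case by (simp add: disjoint_family_on_def)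
next
  case (Suc q)
  then obtain P where P: "\<forall>j<q. P j \<subseteq> A \<and> card (P j) = a" "disjoint_family_on P {..<q}" by auto
  have "card (\<Union>j<q. P j) \<le> (\<Sum>j<q. card (P j))" by (rule card_UN_le) simp
  also have "\<dots> = a * q" using P by simp
  finally have "a \<le> card A - card (\<Union>j<q. P j)" using Suc.prems by simp
  also have "\<dots> \<le> card (A - (\<Union>j<q. P j))" by (rule diff_card_le_card_Diff) (use P assms in \<open>auto intro: finite_subset\<close>)
  finally obtain B where B: "B \<subseteq> A - (\<Union>j<q. P j)" "card B = a" using obtain_subset_with_card_n by metis
  have "\<forall>j<Suc q. (P(q := B)) j \<subseteq> A \<and> card ((P(q := B)) j) = a" using P B by (auto simp: less_Suc_eq)
  moreover have "disjoint_family_on (P(q := B)) {..<Suc q}"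
    using P(2) B(1) unfolding disjoint_family_on_def lessThan_Suc by auto
  ultimately show ?case by blast
qed

context simple_edges
begin

text \<open>Edges of \<open>F\<close> that do not cross lie inside \<open>X\<close> or
  \<open>V - X\<close>. Subtracting both capacities from that of \<open>V\<close> leaves
  \<open>2 * \<kappa> - 1\<close>. A side with one vertex spans no edge, and subtracting the other
  capacity leaves \<open>\<kappa>\<close>; on two vertices the whole capacity 1 crosses.\<close>

lemma sparse_cut:
  assumes F: "F \<subseteq> E" "count_sparse \<kappa> V F" "int (card F) = capacity \<kappa> V" and X: "X \<noteq> {}" "X \<subset> V"
  shows "2 \<le> card X \<Longrightarrow> 2 \<le> card (V - X) \<Longrightarrow> 2 * \<kappa> - 1 \<le> int (card {e\<in>F. card (e \<inter> X) = 1})"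
    and "3 \<le> card V \<Longrightarrow> card X = 1 \<or> card (V - X) = 1 \<Longrightarrow> \<kappa> \<le> int (card {e\<in>F. card (e \<inter> X) = 1})"
    and "card V = 2 \<Longrightarrow> 1 \<le> int (card {e\<in>F. card (e \<inter> X) = 1})"
proof -
  have fin: "finite X" "finite (V - X)" "finite F"
    using X finite_V finite_edges[OF F(1)] by (auto intro: finite_subset)
  have "F \<subseteq> (inside F X \<union> inside F (V - X)) \<union> {e\<in>F. card (e \<inter> X) = 1}"
  proof
    fix e assume e: "e \<in> F"
    then have eE: "e \<in> E" using F by auto
    have "card (e \<inter> X) = 0 \<or> card (e \<inter> X) = 1 \<or> card (e \<inter> X) = 2"
      using card_edge_Int(1)[OF eE, of X] by linarith
    then show "e \<in> (inside F X \<union> inside F (V - X)) \<union> {e\<in>F. card (e \<inter> X) = 1}"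
      using e card_edge_Int(2,3)[OF eE, of X] edge[OF eE] by (auto simp: inside_def)
  qed
  then have "card F \<le> card ((inside F X \<union> inside F (V - X)) \<union> {e\<in>F. card (e \<inter> X) = 1})"
    using fin by (intro card_mono) (auto simp: finite_inside)
  also have "\<dots> \<le> card (inside F X \<union> inside F (V - X)) + card {e\<in>F. card (e \<inter> X) = 1}"
    by (rule card_Un_le)
  also have "card (inside F X \<union> inside F (V - X)) \<le> card (inside F X) + card (inside F (V - X))"
    by (rule card_Un_le)
  finally have cut: "capacity \<kappa> V \<le> int (card (inside F X)) + int (card (inside F (V - X)))
      + int (card {e\<in>F. card (e \<inter> X) = 1})"
    using F(3) by linarith
  have big: "int (card (inside F A)) \<le> capacity \<kappa> A" if "A \<subseteq> V" "2 \<le> card A" for A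
    using F(2) that by (simp add: count_sparse_def)
  have small: "card (inside F A) = 0" if "finite A" "card A = 1" for A
    using inside_small[OF F(1), of A] that by simp
  have card: "int (card V) = int (card X) + int (card (V - X))"
    using card_Un_disjoint[OF fin(1,2)] X by (auto simp: Un_absorb1)
  then have cardk: "\<kappa> * int (card V) = \<kappa> * int (card X) + \<kappa> * int (card (V - X))"
    by (simp add: distrib_left)
  have XV: "X \<subseteq> V" "V - X \<subseteq> V" using X by auto
  show "2 * \<kappa> - 1 \<le> int (card {e\<in>F. card (e \<inter> X) = 1})" if "2 \<le> card X" "2 \<le> card (V - X)"
    using cut big[OF XV(1) that(1)] big[OF XV(2) that(2)] cardk by (simp add: capacity_def)
  show "\<kappa> \<le> int (card {e\<in>F. card (e \<inter> X) = 1})" if "3 \<le> card V" "card X = 1 \<or> card (V - X) = 1"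
    using that(2)
  proof
    assume 1: "card X = 1"
    then have "2 \<le> card (V - X)" using that(1) card by linarith
    then show ?thesis
      using cut big[OF XV(2)] small[OF fin(1) 1] cardk 1 by (simp add: capacity_def)
  next
    assume 1: "card (V - X) = 1"
    then have "2 \<le> card X" using that(1) card by linarith
    then show ?thesis
      using cut big[OF XV(1)] small[OF fin(2) 1] cardk 1 by (simp add: capacity_def)
  qed
  show "1 \<le> int (card {e\<in>F. card (e \<inter> X) = 1})" if V2: "card V = 2"
  proof -
    have "card X \<noteq> 0" "card (V - X) \<noteq> 0" using X fin by auto
    then have "card X = 1" "card (V - X) = 1" using card V2 by linarith+
    then show ?thesis using cut small fin V2 by (simp add: capacity_def)
  qed
qed

text \<open>Some edge of \<open>F\<close> leaves any set of reachable vertices other than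
  \<open>V\<close>, by \<open>sparse_cut\<close>. A cycle would span as many edges as vertices, one
  more than the capacity.\<close>

lemma sparse_1_is_tree:
  assumes V: "2 \<le> card V" and F: "F \<subseteq> E" "count_sparse 1 V F" "int (card F) = capacity 1 V"
  shows "is_tree \<lparr>vertices = V, edges = F\<rparr>"
  unfolding is_tree_def
proof
  let ?R = "{(x, y). {x, y} \<in> F}"
  show "connected_graph \<lparr>vertices = V, edges = F\<rparr>"
    unfolding connected_graph_def graph.simps
  proof (intro ballI, rule ccontr)
    fix u v assume uv: "u \<in> V" "v \<in> V" "(u, v) \<notin> ?R\<^sup>*"
    define X where "X = {x\<in>V. (u, x) \<in> ?R\<^sup>*}"
    have X: "X \<noteq> {}" "X \<subset> V" using uv by (auto simp: X_def)
    then have ne: "card X \<noteq> 0" "card (V - X) \<noteq> 0"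
      using finite_V finite_subset[of X V] by auto
    have "1 \<le> int (card {e\<in>F. card (e \<inter> X) = 1})"
    proof (cases "2 \<le> card X \<and> 2 \<le> card (V - X)")
      case True
      then show ?thesis using sparse_cut(1)[OF F X] by auto
    next
      case False
      then have "card X = 1 \<or> card (V - X) = 1" using ne by linarith
      then show ?thesis using sparse_cut(2,3)[OF F X] V by (cases "card V = 2") auto
    qed
    then have "card {e\<in>F. card (e \<inter> X) = 1} \<noteq> 0" by linarith
    then have "{e\<in>F. card (e \<inter> X) = 1} \<noteq> {}" by (metis card.empty)
    then obtain e where e: "e \<in> F" "card (e \<inter> X) = 1" by auto
    obtain x y where xy: "e = {x, y}" using edge[of e] e F(1) by (auto simp: card_2_iff)
    have eV: "e \<subseteq> V" using edge[of e] e F(1) by auto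
    have "\<not> e \<subseteq> X" using e F(1) card_edge_Int(2)[of e X] by auto
    moreover have "e \<inter> X \<noteq> {}" using e(2) by auto
    ultimately obtain a b where ab: "e = {a, b}" "a \<in> X" "b \<notin> X"
      using xy by (metis disjoint_iff insert_commute insert_iff singletonD subsetI)
    have "(a, b) \<in> ?R" using e ab by auto
    then have "(u, b) \<in> ?R\<^sup>*" using ab(2) by (auto simp: X_def intro: rtrancl_into_rtrancl)
    then show False using ab eV by (auto simp: X_def)
  qed
  show "\<nexists>cs. is_cycle \<lparr>vertices = V, edges = F\<rparr> cs"
  proof
    assume "\<exists>cs. is_cycle \<lparr>vertices = V, edges = F\<rparr> cs"
    then obtain cs where "is_cycle \<lparr>vertices = V, edges = F\<rparr> cs" by blast
    then have cs: "3 \<le> length cs" "distinct cs"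
      "\<And>i. i < length cs \<Longrightarrow> {cs ! i, cs ! (Suc i mod length cs)} \<in> F"
      by (auto simp: is_cycle_def)
    let ?n = "length cs"
    let ?e = "\<lambda>i. {cs ! i, cs ! (Suc i mod ?n)}"
    have mod: "Suc i mod ?n < ?n" for i using cs(1) by (intro mod_less_divisor) linarith
    have "inj_on ?e {..<?n}"
    proof (rule inj_onI)
      fix i j assume ij: "i \<in> {..<?n}" "j \<in> {..<?n}" "?e i = ?e j"
      then have lt: "i < ?n" "j < ?n" by auto
      \<comment> \<open>Equal edges have the same index, or each index is the cyclic successor of
        the other, which length at least three excludes.\<close>
      have "i = j \<or> i = Suc j mod ?n \<and> j = Suc i mod ?n"
        using ij(3) lt mod cs(2) by (auto simp: doubleton_eq_iff nth_eq_iff_index_eq)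
      moreover have "\<not> (i = Suc j mod ?n \<and> j = Suc i mod ?n)"
        using lt cs(1) by (auto simp: mod_Suc)
      ultimately show "i = j" by blast
    qed
    then have "card (?e ` {..<?n}) = ?n" by (simp add: card_image)
    moreover have "?e ` {..<?n} \<subseteq> inside F (set cs)" using cs(3) mod by (auto simp: inside_def)
    then have "card (?e ` {..<?n}) \<le> card (inside F (set cs))"
      using finite_edges[OF F(1)] by (intro card_mono finite_inside)
    moreover have sub: "set cs \<subseteq> V"
    proof
      fix v assume "v \<in> set cs"
      then obtain i where i: "i < ?n" "v = cs ! i" by (metis in_set_conv_nth)
      then show "v \<in> V" using cs(3)[OF i(1)] edge F(1) by blast
    qed
    moreover have len: "card (set cs) = ?n" using cs(2) by (rule distinct_card)
    moreover have "2 \<le> card (set cs)" using len cs(1) by linarith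
    then have "int (card (inside F (set cs))) \<le> capacity 1 (set cs)"
      using F(2) sub unfolding count_sparse_def by blast
    ultimately show False by (simp add: capacity_def)
  qed
qed

lemma sum_ell:
  assumes "A \<subseteq> V" "2 \<le> card A"
  shows "(\<Sum>v\<in>A. ell \<kappa> (2 * \<kappa> - 1) {v}) - ell \<kappa> (2 * \<kappa> - 1) A = capacity \<kappa> A"
  using assms by (auto simp: ell_def capacity_def)

lemma sparse_ell:
  assumes F: "F \<subseteq> E" "count_sparse \<kappa> V F"
  shows "sparse (ell \<kappa> (2 * \<kappa> - 1)) \<lparr>vertices = V, edges = F\<rparr>"
  unfolding sparse_def graph.simps
proof (intro allI impI)
  fix A assume A: "A \<subseteq> V"
  then have fin: "finite A" using finite_V finite_subset by auto
  have eq: "induced_size \<lparr>vertices = V, edges = F\<rparr> A = card (inside F A)"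
    by (simp add: induced_size_def inside_def)
  show "int (induced_size \<lparr>vertices = V, edges = F\<rparr> A)
    \<le> (\<Sum>v\<in>A. ell \<kappa> (2 * \<kappa> - 1) {v}) - ell \<kappa> (2 * \<kappa> - 1) A"
  proof (cases "2 \<le> card A")
    case True
    then show ?thesis using F(2) A by (simp add: eq sum_ell count_sparse_def)
  next
    case False
    then have "inside F A = {}" using inside_small[OF F(1) fin] by auto
    moreover have "A = {} \<or> card A = 1" using False fin by (cases "card A") auto
    ultimately show ?thesis using eq by (auto simp: ell_def)
  qed
qed

end

section \<open>Packing the sparse sets and enlarging those of the rigid graphs\<close>

lemma sum_if_less:
  fixes a b :: int
  shows "(\<Sum>i<m + p. if i < m then a else b) = int m * a + int p * b"
  by (induction p) (auto simp: algebra_simps)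

context weakly_connected_edges
begin

definition \<kappa> :: "nat \<Rightarrow> int" where "\<kappa> i = (if i < m then 1 else int k)"

lemma \<kappa>_ge: "1 \<le> \<kappa> i"
  using k by (simp add: \<kappa>_def)

lemma sum_capacity: "(\<Sum>i<m + p. capacity (\<kappa> i) V) = c * int (card V) - T"
proof -
  have "(\<Sum>i<m + p. capacity (\<kappa> i) V) = (\<Sum>i<m + p. if i < m then capacity 1 V else capacity (int k) V)"
    by (intro sum.cong) (auto simp: \<kappa>_def)
  then show ?thesis by (simp add: sum_if_less capacity_def c_def T_def algebra_simps)
qed

text \<open>Let \<open>S\<close> attain the touch rank of \<open>D\<close>, the edges with some copy
  outside \<open>W\<close>. The edges avoiding \<open>S\<close> and not in \<open>D\<close> have all
  their copies in \<open>W\<close>, and \<open>rank_bound\<close> applies to them with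
  \<open>U = V - S\<close>.\<close>

lemma intersection_bound:
  assumes W: "W \<subseteq> E \<times> {..<m + p}"
  shows "c * int (card V) - T \<le> (\<Sum>i<m + p. count_rank (\<kappa> i) V {e. (e, i) \<in> W})
    + touch_rank V (degree_slack E g) (fst ` (E \<times> {..<m + p} - W))"
proof -
  define D where "D = fst ` (E \<times> {..<m + p} - W)"
  have DE: "D \<subseteq> E" by (auto simp: D_def)
  obtain S where S: "S \<subseteq> V"
    "touch_rank V (degree_slack E g) D = degree_slack E g S + int (card {e\<in>D. e \<inter> S = {}})"
    using touch_rank_attained .
  define Y where "Y = inside E (V - S) - D"
  have VS: "V - (V - S) = S" using S by auto
  have "e \<subseteq> V - S \<longleftrightarrow> e \<inter> S = {}" if "e \<in> E" for e using edge[OF that] by auto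
  then have D: "inside E (V - S) - Y = {e\<in>D. e \<inter> S = {}}"
    using DE unfolding Y_def inside_def by blast
  have YE: "Y \<subseteq> E" by (auto simp: Y_def inside_def)
  have Yi: "Y \<subseteq> {e. (e, i) \<in> W}" if i: "i < m + p" for i
  proof
    fix e assume e: "e \<in> Y"
    then have "e \<in> E" "e \<notin> D" using YE by (auto simp: Y_def)
    then show "e \<in> {e. (e, i) \<in> W}" using i by (force simp: D_def)
  qed
  have "int p * count_rank (int k) V Y + int m * count_rank 1 V Y
      = (\<Sum>i<m + p. if i < m then count_rank 1 V Y else count_rank (int k) V Y)"
    by (simp add: sum_if_less)
  also have "\<dots> = (\<Sum>i<m + p. count_rank (\<kappa> i) V Y)" by (intro sum.cong) (auto simp: \<kappa>_def)
  also have "\<dots> \<le> (\<Sum>i<m + p. count_rank (\<kappa> i) V {e. (e, i) \<in> W})"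
    using Yi W \<kappa>_ge by (intro sum_mono count_rank_mono) auto
  finally have "int p * count_rank (int k) V Y + int m * count_rank 1 V Y
    \<le> (\<Sum>i<m + p. count_rank (\<kappa> i) V {e. (e, i) \<in> W})" .
  moreover have "c * int (card V) - T \<le> int p * count_rank (int k) V Y + int m * count_rank 1 V Y
    + int (card (inside E (V - S) - Y)) + degree_slack E g (V - (V - S))"
    by (rule rank_bound) (auto simp: Y_def)
  ultimately show ?thesis unfolding D_def[symmetric] S(2) D VS by linarith
qed

text \<open>Matroid intersection gives a common independent set of copies as large as all capacities
  of \<open>V\<close> together. The first matroid makes each \<open>F i\<close> sparse; the second
  yields disjointness and the degree condition.\<close>

lemma packing:
  obtains F where "\<And>i. i < m + p \<Longrightarrow> F i \<subseteq> E" "\<And>i. i < m + p \<Longrightarrow> count_sparse (\<kappa> i) V (F i)"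
    "\<And>i. i < m + p \<Longrightarrow> int (card (F i)) = capacity (\<kappa> i) V"
    "disjoint_family_on F {..<m + p}"
    "\<And>X. X \<subseteq> V \<Longrightarrow> int (card {e\<in>\<Union>i<m + p. F i. e \<inter> X \<noteq> {}}) \<le> degree_slack E g X"
proof -
  have g: "int (card {e\<in>E. v \<in> e}) \<le> 2 * g v" for v using c_nonneg by (simp add: g_def)
  let ?r1 = "\<lambda>W. \<Sum>i<m + p. count_rank (\<kappa> i) V {e. (e, i) \<in> W}"
  let ?r2 = "\<lambda>W. touch_rank V (degree_slack E g) (fst ` W)"
  have "\<exists>I\<subseteq>E \<times> {..<m + p}. ?r1 I = int (card I) \<and> ?r2 I = int (card I) \<and> c * int (card V) - T \<le> int (card I)"
  proof (rule matroid_intersection)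
    show "finite (E \<times> {..<m + p})" using finite_E by simp
    show "rank_function (E \<times> {..<m + p}) ?r1"
      by (rule rank_function_sum) (auto intro: rank_function_count_rank \<kappa>_ge)
    show "rank_function (E \<times> {..<m + p}) ?r2"
      by (rule rank_function_fst[OF rank_function_degree_slack[OF g] touch_rank_mono])
  qed (rule intersection_bound)
  then obtain I where I: "I \<subseteq> E \<times> {..<m + p}" "?r1 I = int (card I)" "?r2 I = int (card I)"
    "c * int (card V) - T \<le> int (card I)" by blast
  have finI: "finite I" using I(1) finite_E by (auto intro: finite_subset)
  define F where "F i = {e. (e, i) \<in> I}" for i
  have FE: "F i \<subseteq> E" for i using I(1) by (auto simp: F_def)
  have "I = (\<lambda>(i, e). (e, i)) ` Sigma {..<m + p} F"
    using I(1) by (force simp: F_def)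
  then have "card I = card (Sigma {..<m + p} F)"
    by (metis (no_types, lifting) card_image inj_onI case_prod_conv prod.collapse swap_simp prod.inject split_beta)
  then have cardI: "int (card I) = (\<Sum>i<m + p. int (card (F i)))"
    using finite_edges[OF FE] by simp
  have rank_le: "count_rank (\<kappa> i) V (F i) \<le> int (card (F i))" for i
  proof -
    obtain F' where "F' \<subseteq> F i" "count_rank (\<kappa> i) V (F i) = int (card F')"
      using count_rank_attained[OF FE \<kappa>_ge, of i i] by metis
    then show ?thesis using card_mono[OF finite_edges[OF FE]] by fastforce
  qed
  \<comment> \<open>Each rank is at most the size and the sums agree, so every term agrees. The
    capacities are handled in the same way below.\<close>
  have "count_rank (\<kappa> i) V (F i) = int (card (F i))" if "i < m + p" for i
    by (rule sum_mono_inv[OF _ rank_le]) (use I(2) cardI that in \<open>auto simp: F_def\<close>)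
  then have sparse: "count_sparse (\<kappa> i) V (F i)" if "i < m + p" for i
    using count_rank_attained[OF FE \<kappa>_ge, of i i] card_subset_eq[OF finite_edges[OF FE]] that
    by (metis of_nat_eq_iff)
  have "inside (F i) V = F i" for i using FE[of i] edge by (auto simp: inside_def)
  then have cap: "int (card (F i)) \<le> capacity (\<kappa> i) V" if "i < m + p" for i
    using sparse[OF that] card_V unfolding count_sparse_def by (metis order_refl)
  have "(\<Sum>i<m + p. int (card (F i))) = (\<Sum>i<m + p. capacity (\<kappa> i) V)"
    using sum_mono[of "{..<m + p}" "\<lambda>i. int (card (F i))" "\<lambda>i. capacity (\<kappa> i) V"] cap I(4)
    unfolding cardI sum_capacity by fastforce
  then have card_eq: "int (card (F i)) = capacity (\<kappa> i) V" if "i < m + p" for i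
    by (rule sum_mono_inv) (use cap that in auto)
  have le: "int (card I) \<le> degree_slack E g X + int (card {e\<in>fst ` I. e \<inter> X = {}})" if "X \<subseteq> V" for X
    using touch_rank_le[OF that, of "degree_slack E g" "fst ` I"] I(3) by simp
  have "inside E {} = {}" by (rule inside_small) auto
  \<comment> \<open>The touch bound at the empty set has no slack term, so \<open>fst\<close> is
    injective on \<open>I\<close>: no edge is used in two copies.\<close>
  then have "card I \<le> card (fst ` I)" using le[of "{}"] by (simp add: degree_slack_def)
  then have card_fst: "card (fst ` I) = card I" using card_image_le[OF finI, of fst] by linarith
  then have inj: "inj_on fst I" using finI by (simp add: eq_card_imp_inj_on)
  have "i = j" if "(e, i) \<in> I" "(e, j) \<in> I" for e i j
    using inj_onD[OF inj, of "(e, i)" "(e, j)"] that by simp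
  then have "disjoint_family_on F {..<m + p}"
    unfolding disjoint_family_on_def F_def by blast
  moreover have "(\<Union>i<m + p. F i) = fst ` I" using I(1) by (force simp: F_def)
  moreover have "int (card {e\<in>fst ` I. e \<inter> X \<noteq> {}}) \<le> degree_slack E g X" if "X \<subseteq> V" for X
  proof -
    have "card (fst ` I) = card ({e\<in>fst ` I. e \<inter> X \<noteq> {}} \<union> {e\<in>fst ` I. e \<inter> X = {}})"
      by (rule arg_cong[where f = card]) auto
    also have "\<dots> = card {e\<in>fst ` I. e \<inter> X \<noteq> {}} + card {e\<in>fst ` I. e \<inter> X = {}}"
      using finI by (intro card_Un_disjoint) auto
    finally show ?thesis using le[OF that] card_fst by linarith
  qed
  ultimately show thesis using that[of F] FE sparse card_eq by simp
qed

text \<open>Summing the degrees in \<open>F\<close> over \<open>X\<close> counts the edges of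
  \<open>F\<close> meeting \<open>X\<close> once and those inside \<open>X\<close> once more. This
  turns \<open>touch\<close> into the condition of \<open>orientation\<close> for
  \<open>E - F\<close>.\<close>

lemma orientation_of_complement:
  assumes F: "F \<subseteq> E"
    and touch: "\<And>X. X \<subseteq> V \<Longrightarrow> int (card {e\<in>F. e \<inter> X \<noteq> {}}) \<le> degree_slack E g X"
  obtains head where "\<And>e. e \<in> E - F \<Longrightarrow> head e \<in> e"
    "\<And>v. v \<in> V \<Longrightarrow> int (card {e\<in>E - F. head e = v}) + int (card {e\<in>F. v \<in> e}) \<le> g v"
proof -
  have finF: "finite F" using F by (rule finite_edges)
  have "int (card (inside (E - F) X)) \<le> (\<Sum>v\<in>X. g v - int (card {e\<in>F. v \<in> e}))" if X: "X \<subseteq> V" for X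
  proof -
    have "(\<Sum>v\<in>X. card {e\<in>F. v \<in> e}) = (\<Sum>e\<in>F. card (e \<inter> X))" using sum_degrees[OF F X] .
    also have "\<dots> = (\<Sum>e\<in>F. of_bool (e \<inter> X \<noteq> {}) + of_bool (e \<subseteq> X))"
    proof (rule sum.cong[OF refl])
      fix e assume "e \<in> F"
      then have e: "e \<in> E" "e \<noteq> {}" using F edge[of e] by auto
      have "card (e \<inter> X) = 0 \<or> card (e \<inter> X) = 1 \<or> card (e \<inter> X) = 2"
        using card_edge_Int(1)[OF e(1), of X] by linarith
      then show "card (e \<inter> X) = of_bool (e \<inter> X \<noteq> {}) + of_bool (e \<subseteq> X)"
        using card_edge_Int(2,3)[OF e(1), of X] e(2) by auto
    qed
    also have "\<dots> = card {e\<in>F. e \<inter> X \<noteq> {}} + card (inside F X)"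
      using finF by (simp add: sum.distrib inside_def Int_def)
    finally have "(\<Sum>v\<in>X. int (card {e\<in>F. v \<in> e})) = int (card {e\<in>F. e \<inter> X \<noteq> {}}) + int (card (inside F X))"
      by (simp flip: of_nat_sum)
    moreover have "card (inside E X) = card (inside (E - F) X) + card (inside F X)"
    proof -
      have "inside E X = inside (E - F) X \<union> inside F X" using F by (auto simp: inside_def)
      then show ?thesis using card_Un_disjoint[of "inside (E - F) X" "inside F X"] finF finite_E
        by (auto simp: inside_def)
    qed
    ultimately show ?thesis using touch[OF X] by (simp add: sum_subtractf degree_slack_def)
  qed
  then obtain head where "\<forall>e\<in>E - F. head e \<in> e"
    "\<forall>v\<in>V. int (card {e\<in>E - F. head e = v}) \<le> g v - int (card {e\<in>F. v \<in> e})"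
    using orientation[of "E - F" "\<lambda>v. g v - int (card {e\<in>F. v \<in> e})"] by auto
  then show thesis using that[of head] by force
qed

text \<open>A simple graph on two vertices has degrees at most 1, whereas \<open>p \<ge> 1\<close>
  makes them at least \<open>2 * T\<close>, hence at least 6. It lets \<open>sparse_cut\<close>
  guarantee \<open>k\<close> edges of a rigid graph at each vertex.\<close>

lemma card_V_ge_3:
  assumes "p \<noteq> 0"
  shows "3 \<le> card V"
proof (rule ccontr)
  assume "\<not> 3 \<le> card V"
  then have V2: "card V = 2" using card_V by linarith
  obtain v where v: "v \<in> V" using card_V by fastforce
  have "inside E V = E" using edge by (auto simp: inside_def)
  then have "int (card E) \<le> capacity (int k) V" using card_inside_small[of V E] V2 by auto
  then have "card E \<le> 1" using V2 by (simp add: capacity_def)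
  moreover have "card {e\<in>E. v \<in> e} \<le> card E" using finite_E by (intro card_mono) auto
  moreover have "(2 * int k - 1) * 1 \<le> (2 * int k - 1) * int p" using assms k by (intro mult_left_mono) auto
  then have "2 * int k - 1 \<le> T" unfolding T_def by (simp add: add_increasing2)
  then have "3 \<le> T" using k by linarith
  ultimately show False using degree_ge[OF v] by linarith
qed

lemma rigid_packing:
  obtains H where "\<And>i. i < m + p \<Longrightarrow> H i \<subseteq> E" "disjoint_family_on H {..<m + p}"
    "\<And>i. i < m \<Longrightarrow> is_tree \<lparr>vertices = V, edges = H i\<rparr>"
    "\<And>i. m \<le> i \<Longrightarrow> i < m + p \<Longrightarrow> k_rigid (int k) \<lparr>vertices = V, edges = H i\<rparr>"
    "\<And>i. m \<le> i \<Longrightarrow> i < m + p \<Longrightarrow> edge_connected (2 * int k - 1) \<lparr>vertices = V, edges = H i\<rparr>"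
    "\<And>v. v \<in> V \<Longrightarrow> int (card {e\<in>\<Union>i<m + p. H i. v \<in> e}) \<le> (int (card {e\<in>E. v \<in> e}) + 1) div 2 + T"
proof -
  obtain F where FE: "\<And>i. i < m + p \<Longrightarrow> F i \<subseteq> E"
    and sparse: "\<And>i. i < m + p \<Longrightarrow> count_sparse (\<kappa> i) V (F i)"
    and cardF: "\<And>i. i < m + p \<Longrightarrow> int (card (F i)) = capacity (\<kappa> i) V"
    and disjF: "disjoint_family_on F {..<m + p}"
    and touch: "\<And>X. X \<subseteq> V \<Longrightarrow> int (card {e\<in>\<Union>i<m + p. F i. e \<inter> X \<noteq> {}}) \<le> degree_slack E g X"
    using packing by blast
  define F0 where "F0 = (\<Union>i<m + p. F i)"
  have F0: "F0 \<subseteq> E" using FE by (auto simp: F0_def)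
  obtain head where head: "\<And>e. e \<in> E - F0 \<Longrightarrow> head e \<in> e"
    "\<And>v. v \<in> V \<Longrightarrow> int (card {e\<in>E - F0. head e = v}) + int (card {e\<in>F0. v \<in> e}) \<le> g v"
    using orientation_of_complement[OF F0 touch[folded F0_def]] by blast
  define out where "out v = {e\<in>E - F0. v \<in> e \<and> head e \<noteq> v}" for v
  have fin: "finite (out v)" for v using finite_E by (simp add: out_def)
  \<comment> \<open>In-degree and degree in \<open>F0\<close> total at most half the degree, rounded
    up, plus \<open>c\<close>. As the degree is at least \<open>2 * T\<close>, at least
    \<open>T - c\<close> edges remain.\<close>
  have "(k - 1) * p \<le> card (out v)" if v: "v \<in> V" for v
  proof -
    have "{e\<in>E. v \<in> e} = ({e\<in>E - F0. head e = v} \<union> {e\<in>F0. v \<in> e}) \<union> out v"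
      using F0 head(1) by (auto simp: out_def)
    then have "card {e\<in>E. v \<in> e} \<le> card ({e\<in>E - F0. head e = v} \<union> {e\<in>F0. v \<in> e}) + card (out v)"
      using card_Un_le[of "{e\<in>E - F0. head e = v} \<union> {e\<in>F0. v \<in> e}" "out v"] by simp
    also have "card ({e\<in>E - F0. head e = v} \<union> {e\<in>F0. v \<in> e}) \<le> card {e\<in>E - F0. head e = v} + card {e\<in>F0. v \<in> e}"
      by (rule card_Un_le)
    finally have "int (card {e\<in>E. v \<in> e}) \<le> g v + int (card (out v))" using head(2)[OF v] by linarith
    moreover have "g v \<le> int (card {e\<in>E. v \<in> e}) - T + c" using degree_ge[OF v] by (simp add: g_def)
    moreover have "T - c = int ((k - 1) * p)" using k by (simp add: T_def c_def of_nat_diff algebra_simps)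
    ultimately show ?thesis by linarith
  qed
  then have "\<exists>P. (\<forall>j<p. P j \<subseteq> out v \<and> card (P j) = k - 1) \<and> disjoint_family_on P {..<p}" if "v \<in> V" for v
    using disjoint_subsets_of_card[OF fin] that by simp
  then obtain P where P: "\<And>v j. v \<in> V \<Longrightarrow> j < p \<Longrightarrow> P v j \<subseteq> out v \<and> card (P v j) = k - 1"
    "\<And>v. v \<in> V \<Longrightarrow> disjoint_family_on (P v) {..<p}" by metis
  \<comment> \<open>Each edge outside \<open>F0\<close> has a single tail, so different vertices
    never hand out the same edge.\<close>
  have out_disjoint: "v = w" if "e \<in> out v" "e \<in> out w" for e v w
  proof -
    have e: "e \<in> E" "v \<in> e" "w \<in> e" "head e \<noteq> v" "head e \<noteq> w" "head e \<in> e"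
      using that head(1) by (auto simp: out_def)
    obtain x y where "e = {x, y}" using edge[OF e(1)] by (auto simp: card_2_iff)
    then show ?thesis using e by auto
  qed
  \<comment> \<open>All edges handed to the \<open>j\<close>-th rigid graph, which has index
    \<open>m + j\<close> in the packing.\<close>
  define X where "X j = (\<Union>v\<in>V. P v j)" for j
  have XE: "X j \<subseteq> E - F0" if "j < p" for j
    unfolding X_def
  proof (rule UN_least)
    fix v assume "v \<in> V"
    then show "P v j \<subseteq> E - F0" using P(1)[of v j] that by (auto simp: out_def)
  qed
  have XE': "X (i - m) \<subseteq> E - F0" if "\<not> i < m" "i < m + p" for i
    by (rule XE) (use that in linarith)
  have Xdisj: "X i \<inter> X j = {}" if "i < p" "j < p" "i \<noteq> j" for i j
  proof -
    have False if e: "e \<in> P v i" "e \<in> P w j" and vw: "v \<in> V" "w \<in> V" for e v w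
    proof -
      have "v = w"
        using out_disjoint[of e v w] e P(1)[OF vw(1) \<open>i < p\<close>] P(1)[OF vw(2) \<open>j < p\<close>] by auto
      then show False
        using P(2)[OF vw(1)] e \<open>i < p\<close> \<open>j < p\<close> \<open>i \<noteq> j\<close> unfolding disjoint_family_on_def by blast
    qed
    then show ?thesis by (auto simp: X_def)
  qed
  define H where "H i = (if i < m then F i else F i \<union> X (i - m))" for i
  have FF0: "F i \<subseteq> F0" if "i < m + p" for i using that by (auto simp: F0_def)
  have HE: "H i \<subseteq> E" if "i < m + p" for i
    using FE[OF that] XE'[of i] that by (auto simp: H_def)
  show thesis
  proof (rule that[OF HE])
    show "disjoint_family_on H {..<m + p}"
      unfolding disjoint_family_on_def
    proof (intro ballI impI)
      fix i j assume ij: "i \<in> {..<m + p}" "j \<in> {..<m + p}" "i \<noteq> j"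
      have "F i \<inter> F j = {}" using disjF ij unfolding disjoint_family_on_def by blast
      moreover have "F i \<inter> X (j - m) = {}" if "\<not> j < m" using FF0[of i] XE'[of j] ij that by auto
      moreover have "F j \<inter> X (i - m) = {}" if "\<not> i < m" using FF0[of j] XE'[of i] ij that by auto
      moreover have "X (i - m) \<inter> X (j - m) = {}" if "\<not> i < m" "\<not> j < m"
        by (rule Xdisj) (use ij that in auto)
      ultimately show "H i \<inter> H j = {}" by (auto simp: H_def)
    qed
  next
    fix i assume i: "i < m"
    then show "is_tree \<lparr>vertices = V, edges = H i\<rparr>"
      using sparse_1_is_tree[OF card_V FE, of i] sparse[of i] cardF[of i] by (simp add: H_def \<kappa>_def)
  next
    fix i assume i: "m \<le> i" "i < m + p"
    then have ki: "\<kappa> i = int k" and Hi: "H i = F i \<union> X (i - m)" by (auto simp: \<kappa>_def H_def)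
    note Fi = FE[OF i(2)] sparse[OF i(2), unfolded ki] cardF[OF i(2), unfolded ki]
    show "k_rigid (int k) \<lparr>vertices = V, edges = H i\<rparr>"
      unfolding k_rigid_def rigid_def
      using Fi sparse_ell[OF Fi(1,2)] sum_ell[OF order_refl card_V, of "int k"]
      by (intro exI[of _ "\<lparr>vertices = V, edges = F i\<rparr>"]) (auto simp: spanning_subgraph_def Hi)
    show "edge_connected (2 * int k - 1) \<lparr>vertices = V, edges = H i\<rparr>"
      unfolding edge_connected_def cut_size_def graph.simps
    proof (intro allI impI)
      fix A assume "A \<noteq> {} \<and> A \<subset> V"
      then have A: "A \<noteq> {}" "A \<subset> V" by auto
      then have ne: "card A \<noteq> 0" "card (V - A) \<noteq> 0"
        using finite_V finite_subset[of A V] by auto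
      have finH: "finite (H i)" using HE[OF i(2)] by (rule finite_edges)
      show "2 * int k - 1 \<le> int (card {e\<in>H i. card (e \<inter> A) = 1})"
      proof (cases "2 \<le> card A \<and> 2 \<le> card (V - A)")
        case True
        then have "2 * int k - 1 \<le> int (card {e\<in>F i. card (e \<inter> A) = 1})"
          using sparse_cut(1)[OF Fi A] by simp
        also have "\<dots> \<le> int (card {e\<in>H i. card (e \<inter> A) = 1})"
          using finH by (intro of_nat_mono card_mono) (auto simp: Hi)
        finally show ?thesis .
      next
        case False
        \<comment> \<open>A cut around one vertex \<open>v\<close> has at least \<open>k\<close>
          edges of \<open>F i\<close>, and the \<open>k - 1\<close> edges that \<open>v\<close>
          hands out cross it as well.\<close>
        then have single: "card A = 1 \<or> card (V - A) = 1" using ne by linarith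
        then obtain v where v: "A = {v} \<or> V - A = {v}" by (metis card_1_singletonE)
        then have vV: "v \<in> V" using A by auto
        have j: "i - m < p" using i by auto
        note Pv = P(1)[OF vV j]
        have "card (e \<inter> A) = 1" if "e \<in> P v (i - m)" for e
        proof -
          have e: "e \<in> E" "v \<in> e" using that Pv by (auto simp: out_def)
          then have "e \<inter> {v} = {v}" by auto
          then show ?thesis using v card_edge_split[OF e(1), of A] A by auto
        qed
        moreover have "P v (i - m) \<subseteq> H i" using vV by (auto simp: Hi X_def)
        ultimately have "{e\<in>F i. card (e \<inter> A) = 1} \<union> P v (i - m) \<subseteq> {e\<in>H i. card (e \<inter> A) = 1}"
          by (auto simp: Hi)
        then have "card ({e\<in>F i. card (e \<inter> A) = 1} \<union> P v (i - m)) \<le> card {e\<in>H i. card (e \<inter> A) = 1}"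
          using finH by (intro card_mono) auto
        moreover have "card ({e\<in>F i. card (e \<inter> A) = 1} \<union> P v (i - m))
            = card {e\<in>F i. card (e \<inter> A) = 1} + card (P v (i - m))"
          using finite_edges[OF Fi(1)] Pv fin FF0[OF i(2)]
          by (intro card_Un_disjoint) (auto simp: out_def intro: finite_subset)
        moreover have "int k \<le> int (card {e\<in>F i. card (e \<inter> A) = 1})"
          using sparse_cut(2)[OF Fi A card_V_ge_3 single] i by auto
        ultimately show ?thesis using Pv k by auto
      qed
    qed
  next
    fix v assume v: "v \<in> V"
    have finP: "finite (P v j)" if "j < p" for j
      using P(1)[OF v that] fin[of v] finite_subset by blast
    \<comment> \<open>An added edge at \<open>v\<close> was handed out by its tail: either its head
      is \<open>v\<close>, which \<open>g v\<close> already accounts for, or it is one of the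
      \<open>(k - 1) * p\<close> edges from \<open>v\<close> itself.\<close>
    have "{e\<in>\<Union>i<m + p. H i. v \<in> e}
        \<subseteq> ({e\<in>E - F0. head e = v} \<union> {e\<in>F0. v \<in> e}) \<union> (\<Union>j<p. P v j)"
    proof
      fix e assume "e \<in> {e\<in>\<Union>i<m + p. H i. v \<in> e}"
      then obtain i where e: "i < m + p" "e \<in> H i" "v \<in> e" by auto
      show "e \<in> ({e\<in>E - F0. head e = v} \<union> {e\<in>F0. v \<in> e}) \<union> (\<Union>j<p. P v j)"
      proof (cases "e \<in> F i")
        case True
        then show ?thesis using e FF0 by auto
      next
        case False
        then have i: "\<not> i < m" "e \<in> X (i - m)" using e by (auto simp: H_def split: if_splits)
        then have j: "i - m < p" using e by auto
        then have eE: "e \<in> E - F0" using XE i by auto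
        obtain w where w: "w \<in> V" "e \<in> P w (i - m)" using i by (auto simp: X_def)
        show ?thesis
        proof (cases "head e = v")
          case True
          then show ?thesis using eE by auto
        next
          case False
          then have "e \<in> out v" using eE e by (auto simp: out_def)
          moreover have "e \<in> out w" using w P(1)[OF w(1) j] by auto
          ultimately have "w = v" by (rule out_disjoint[symmetric])
          then show ?thesis using w j by auto
        qed
      qed
    qed
    then have "card {e\<in>\<Union>i<m + p. H i. v \<in> e}
        \<le> card (({e\<in>E - F0. head e = v} \<union> {e\<in>F0. v \<in> e}) \<union> (\<Union>j<p. P v j))"
      using finite_E finite_edges[OF F0] finP by (intro card_mono) auto
    also have "\<dots> \<le> card ({e\<in>E - F0. head e = v} \<union> {e\<in>F0. v \<in> e}) + card (\<Union>j<p. P v j)"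
      by (rule card_Un_le)
    also have "card (\<Union>j<p. P v j) \<le> (\<Sum>j<p. card (P v j))" by (rule card_UN_le) simp
    also have "\<dots> = (k - 1) * p" using P(1)[OF v] by simp
    also have "card ({e\<in>E - F0. head e = v} \<union> {e\<in>F0. v \<in> e})
        \<le> card {e\<in>E - F0. head e = v} + card {e\<in>F0. v \<in> e}" by (rule card_Un_le)
    finally have "int (card {e\<in>\<Union>i<m + p. H i. v \<in> e}) \<le> g v + int ((k - 1) * p)"
      using head(2)[OF v] by linarith
    moreover have "T - c = int ((k - 1) * p)" using k by (simp add: T_def c_def of_nat_diff algebra_simps)
    ultimately show "int (card {e\<in>\<Union>i<m + p. H i. v \<in> e}) \<le> (int (card {e\<in>E. v \<in> e}) + 1) div 2 + T"
      by (simp add: g_def)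
  qed
qed

end

section \<open>Transfer to graphs, and graphs with at most one vertex\<close>

lemma half_le_ceiling: "(int d + 1) div 2 \<le> \<lceil>real d / 2\<rceil>"
proof -
  have "2 * ((int d + 1) div 2) \<le> int d + 1" by simp
  then have "2 * real_of_int ((int d + 1) div 2) \<le> real d + 1" by linarith
  then show ?thesis by (simp add: le_ceiling_iff)
qed

text \<open>With at most one vertex there is no nonempty proper vertex subset to cut off, and every
  sparsity bound is zero.\<close>

lemma no_edges_is_tree_and_rigid:
  assumes V: "finite V" "card V \<le> 1"
  shows "is_tree \<lparr>vertices = V, edges = {}\<rparr>" "k_rigid k \<lparr>vertices = V, edges = {}\<rparr>"
    "edge_connected t \<lparr>vertices = V, edges = {}\<rparr>"
proof -
  have single: "u = v" if "u \<in> V" "v \<in> V" for u v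
    using V that by (metis One_nat_def card_le_Suc0_iff_eq)
  have "\<not> is_cycle \<lparr>vertices = V, edges = {}\<rparr> cs" for cs
    by (auto simp: is_cycle_def intro!: exI[of _ 0])
  then show "is_tree \<lparr>vertices = V, edges = {}\<rparr>"
    using single by (auto simp: is_tree_def connected_graph_def)
  have sub: "A = {} \<or> card A = 1" if "A \<subseteq> V" for A
    using V that card_mono[of V A] finite_subset[OF that] by (cases "card A") auto
  have "(\<Sum>v\<in>A. ell k (2 * k - 1) {v}) - ell k (2 * k - 1) A = 0" if "A \<subseteq> V" for A
    using sub[OF that] by (auto simp: ell_def)
  then show "k_rigid k \<lparr>vertices = V, edges = {}\<rparr>"
    unfolding k_rigid_def rigid_def sparse_def
    by (intro exI[of _ "\<lparr>vertices = V, edges = {}\<rparr>"]) (auto simp: spanning_subgraph_def induced_size_def)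
  show "edge_connected t \<lparr>vertices = V, edges = {}\<rparr>"
    unfolding edge_connected_def using single by auto
qed

theorem theorem10p2:
  fixes G :: "'a graph" and k p m :: nat
  assumes "simple_graph G"
    and "2 \<le> k"
    and "weakly_connected (int k) (4 * int k * int p - 2 * int p + 2 * int m) G"
  shows "\<exists>H. spanning_subgraph H G \<and>
    (\<exists>F :: nat \<Rightarrow> 'a graph.
       (\<forall>i<m + p. spanning_subgraph (F i) H) \<and>
       disjoint_family_on (\<lambda>i. edges (F i)) {..<m + p} \<and>
       (\<forall>i<m. is_tree (F i)) \<and>
       (\<forall>i\<in>{m..<m + p}. k_rigid (int k) (F i) \<and> edge_connected (2 * int k - 1) (F i))) \<and>
    (\<forall>v\<in>vertices G. int (degree H v) \<le>
       \<lceil>real (degree G v) / 2\<rceil> + 2 * int k * int p - int p + int m)"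
proof (cases "2 \<le> card (vertices G)")
  case True
  let ?V = "vertices G" and ?E = "edges G"
  interpret weakly_connected_edges ?V ?E k p m
  proof
    show "finite ?V" "\<And>e. e \<in> ?E \<Longrightarrow> e \<subseteq> ?V \<and> card e = 2"
      using assms(1) by (auto simp: simple_graph_def)
    fix A B assume AB: "A \<inter> B = {}" "A \<noteq> {}" "A \<union> B \<subset> ?V"
    have weak: "4 * int k * int p - 2 * int p + 2 * int m - int k * int (card B)
        \<le> int (cut_size (delete_vertices G B) A)"
      using assms(3) AB unfolding weakly_connected_def by blast
    have "{e\<in>edges (delete_vertices G B). card (e \<inter> A) = 1} = {e\<in>?E. e \<inter> B = {} \<and> card (e \<inter> A) = 1}"
      by (auto simp: delete_vertices_def)
    then show "2 * ((2 * int k - 1) * int p + int m) - int k * int (card B)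
        \<le> int (card {e\<in>?E. e \<inter> B = {} \<and> card (e \<inter> A) = 1})"
      using weak by (simp add: cut_size_def algebra_simps)
  qed (use assms True in auto)
  obtain H where H: "\<And>i. i < m + p \<Longrightarrow> H i \<subseteq> ?E" "disjoint_family_on H {..<m + p}"
    "\<And>i. i < m \<Longrightarrow> is_tree \<lparr>vertices = ?V, edges = H i\<rparr>"
    "\<And>i. m \<le> i \<Longrightarrow> i < m + p \<Longrightarrow> k_rigid (int k) \<lparr>vertices = ?V, edges = H i\<rparr>"
    "\<And>i. m \<le> i \<Longrightarrow> i < m + p \<Longrightarrow> edge_connected (2 * int k - 1) \<lparr>vertices = ?V, edges = H i\<rparr>"
    "\<And>v. v \<in> ?V \<Longrightarrow> int (card {e\<in>\<Union>i<m + p. H i. v \<in> e}) \<le> (int (card {e\<in>?E. v \<in> e}) + 1) div 2 + T"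
    using rigid_packing by blast
  have deg: "int (card {e\<in>\<Union>i<m + p. H i. v \<in> e})
      \<le> \<lceil>real (degree G v) / 2\<rceil> + 2 * int k * int p - int p + int m" if "v \<in> ?V" for v
    using H(6)[OF that] half_le_ceiling[of "degree G v"] by (simp add: degree_def T_def algebra_simps)
  show ?thesis
    by (intro exI[of _ "\<lparr>vertices = ?V, edges = \<Union>i<m + p. H i\<rparr>"] conjI
        exI[of _ "\<lambda>i. \<lparr>vertices = ?V, edges = H i\<rparr>"])
      (use H(1-5) deg in \<open>auto simp: spanning_subgraph_def degree_def\<close>)
next
  case False
  let ?G = "\<lparr>vertices = vertices G, edges = {}\<rparr>"
  have V: "finite (vertices G)" "card (vertices G) \<le> 1"
    using assms(1) False by (auto simp: simple_graph_def)
  have "0 \<le> \<lceil>real (degree G v) / 2\<rceil> + 2 * int k * int p - int p + int m" for v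
  proof -
    have "0 \<le> \<lceil>real (degree G v) / 2\<rceil>" using half_le_ceiling[of "degree G v"] by linarith
    moreover have "1 * int p \<le> (2 * int k) * int p" using assms(2) by (intro mult_right_mono) auto
    ultimately show ?thesis by linarith
  qed
  then show ?thesis
    using no_edges_is_tree_and_rigid[OF V]
    by (intro exI[of _ ?G] conjI exI[of _ "\<lambda>_. ?G"])
      (auto simp: spanning_subgraph_def disjoint_family_on_def degree_def)
qed

end
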